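(* Let $n\ge 1$, let $w_1,\dots,w_{n+1}$ be positive integers, and put $\lambda_i=\gcd(w_i,\dots,w_{n+1})$ for $1\le i\le n$. Suppose $\lambda_1=1$. Let $\beta:\mathbb{Z}^{n+1}\to\mathbb{Z}^n$ be given by the $n\times(n+1)$ integer matrix $B$ defined as follows. For $1\le i\le n-1$, the $i$-th row of $B$ has entry $0$ in columns $1,\dots,i-1$, entry $\frac{\lambda_{i+1}}{\lambda_i}$ in column $i$, and entries $b_{ij}$ in columns $j=i+1,\dots,n+1$. The $n$-th row has entry $0$ in columns $1,\dots,n-1$, entry $\frac{w_{n+1}}{\lambda_n}$ in column $n$ and entry $-\frac{w_n}{\lambda_n}$ in column $n+1$. Here the integers $b_{ij}$ are chosen so that $$\frac{\lambda_{i+1}}{\lambda_i}w_i+\sum_{j=i+1}^{n+1}b_{ij}w_j=0\quad\text{for }1\le i\le n-1,$$ $$0\le b_{1i},b_{2i},\dots,b_{i-1,i}<\frac{\lambda_{i+1}}{\lambda_i}\quad\text{for }2\le i\le n-1.$$ Let $\Sigma$ be the fan in $\mathbb{Q}^n$ whose rays are spanned by the columns of $B$ and whose maximal cones are generated by any $n$ of these rays. Then the toric Deligne–Mumford stack associated with the stacky fan $(\mathbb{Z}^n,\Sigma,\beta)$ is the weighted projective orbifold $\mathbb{P}(w_1,\dots,w_{n+1})$.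
   Context: $\mathbb{P}(w_1,\dots,w_{n+1})$ is the quotient stack $[(\mathbb{C}^{n+1}\setminus\{0\})/\mathbb{C}^*]$ with $\mu\cdot(x_1,\dots,x_{n+1})=(\mu^{w_1}x_1,\dots,\mu^{w_{n+1}}x_{n+1})$. A stacky fan (Borisov–Chen–Smith) is a triple $(N,\Sigma,\beta:\mathbb{Z}^k\to N)$ where $N$ is a finitely generated abelian group, $\Sigma$ is a rational simplicial fan in $N\otimes\mathbb{Q}$ with $k$ rays $\rho_1,\dots,\rho_k$, and $\beta$ is a homomorphism with finite cokernel such that $\beta(e_i)\otimes1$ lies on $\rho_i$. Its toric Deligne–Mumford stack is $[Z_\Sigma/G_\beta]$, where $Z_\Sigma=\mathbb{C}^k\setminus V(J_\Sigma)$, $J_\Sigma=\langle\prod_{\rho_i\not\subset\sigma}z_i\mid\sigma\in\Sigma\rangle$, and, for $N$ free, $G_\beta=\mathrm{Hom}_{\mathbb{Z}}(\mathrm{DG}(\beta),\mathbb{C}^* )$ with $\mathrm{DG}(\beta)=\mathrm{coker}(\beta^\star:N^\star\to(\mathbb{Z}^k)^\star)$, $(-)^\star=\mathrm{Hom}_{\mathbb{Z}}(-,\mathbb{Z})$; $G_\beta$ acts on $Z_\Sigma$ through the homomorphism $G_\beta\to(\mathbb{C}^* )^k$ dual to the quotient map $(\mathbb{Z}^k)^\star\to\mathrm{DG}(\beta)$. *)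

theory Defs
  imports "HOL-Algebra.Algebra" "HOL-Algebra.Algebraic_Closure_Type"
begin

section \<open>Categories over a base category\<close>

text \<open>
  \<open>comp C x y z g f\<close> is the composite of \<open>f\<close> in \<open>homs C x y\<close> with \<open>g\<close> in \<open>homs C y z\<close>. The fields
  \<open>pob\<close> and \<open>parr\<close> give the projection to the base category.
\<close>

record ('o, 'm, 'b, 'c) cat_over =
  obs :: "'o set"
  homs :: "'o \<Rightarrow> 'o \<Rightarrow> 'm set"
  ident :: "'o \<Rightarrow> 'm"
  comp :: "'o \<Rightarrow> 'o \<Rightarrow> 'o \<Rightarrow> 'm \<Rightarrow> 'm \<Rightarrow> 'm"
  pob :: "'o \<Rightarrow> 'b"
  parr :: "'m \<Rightarrow> 'c"

definition functor_over ::
    "('o, 'm, 'b, 'c) cat_over \<Rightarrow> ('p, 'n, 'b, 'c) cat_over \<Rightarrow> ('o \<Rightarrow> 'p) \<Rightarrow> ('o \<Rightarrow> 'o \<Rightarrow> 'm \<Rightarrow> 'n) \<Rightarrow> bool"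
  where "functor_over C D F Fm \<longleftrightarrow>
    (\<forall>x\<in>obs C. F x \<in> obs D \<and> pob D (F x) = pob C x \<and> Fm x x (ident C x) = ident D (F x)) \<and>
    (\<forall>x\<in>obs C. \<forall>y\<in>obs C. \<forall>f\<in>homs C x y.
       Fm x y f \<in> homs D (F x) (F y) \<and> parr D (Fm x y f) = parr C f) \<and>
    (\<forall>x\<in>obs C. \<forall>y\<in>obs C. \<forall>z\<in>obs C. \<forall>f\<in>homs C x y. \<forall>g\<in>homs C y z.
       Fm x z (comp C x y z g f) = comp D (F x) (F y) (F z) (Fm y z g) (Fm x y f))"

text \<open>Natural isomorphisms whose components lie over identities of the base.\<close>

definition nat_iso_over ::
    "('o, 'm, 'b, 'c) cat_over \<Rightarrow> ('p, 'n, 'b, 'c) cat_over \<Rightarrow> ('o \<Rightarrow> 'p) \<Rightarrow> ('o \<Rightarrow> 'o \<Rightarrow> 'm \<Rightarrow> 'n) \<Rightarrow>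
     ('o \<Rightarrow> 'p) \<Rightarrow> ('o \<Rightarrow> 'o \<Rightarrow> 'm \<Rightarrow> 'n) \<Rightarrow> bool"
  where "nat_iso_over C D F Fm G Gm \<longleftrightarrow>
    (\<exists>\<eta> \<theta>.
      (\<forall>x\<in>obs C.
         \<eta> x \<in> homs D (F x) (G x) \<and> \<theta> x \<in> homs D (G x) (F x) \<and>
         parr D (\<eta> x) = parr D (ident D (F x)) \<and>
         comp D (F x) (G x) (F x) (\<theta> x) (\<eta> x) = ident D (F x) \<and>
         comp D (G x) (F x) (G x) (\<eta> x) (\<theta> x) = ident D (G x)) \<and>
      (\<forall>x\<in>obs C. \<forall>y\<in>obs C. \<forall>f\<in>homs C x y.
         comp D (F x) (F y) (G y) (\<eta> y) (Fm x y f) = comp D (F x) (G x) (G y) (Gm x y f) (\<eta> x)))"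

definition equivalent_over ::
    "('o, 'm, 'b, 'c) cat_over \<Rightarrow> ('p, 'n, 'b, 'c) cat_over \<Rightarrow> bool"
  where "equivalent_over C D \<longleftrightarrow>
    (\<exists>F Fm G Gm. functor_over C D F Fm \<and> functor_over D C G Gm \<and>
       nat_iso_over C C (\<lambda>x. G (F x)) (\<lambda>x y f. Gm (F x) (F y) (Fm x y f)) (\<lambda>x. x) (\<lambda>x y f. f) \<and>
       nat_iso_over D D (\<lambda>x. F (G x)) (\<lambda>x y f. Fm (G x) (G y) (Gm x y f)) (\<lambda>x. x) (\<lambda>x y f. f))"


section \<open>Affine schemes over the complex numbers and their etale coverings\<close>

text \<open>
  The stacks below are categories over the category of affine schemes over the complex numbers,
  that is, the opposite of the category of commutative algebras over the complex numbers. (A stack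
  on all schemes is determined by its restriction to affine schemes.) The type \<open>'a\<close>
  from which the carriers of the algebras are taken plays the role of the universe: if it is infinite
  of cardinality \<open>\<kappa>\<close>, these are up to isomorphism all algebras of cardinality at most \<open>\<kappa>\<close>.
\<close>

type_synonym 'a calg = "(complex, 'a) module"

abbreviation is_calg :: "'a calg \<Rightarrow> bool"
  where "is_calg A \<equiv> algebra (ring_of_type_algebra :: complex ring) A"

definition calg_hom :: "'a calg \<Rightarrow> 'a calg \<Rightarrow> ('a \<Rightarrow> 'a) set"
  where "calg_hom A B =
    {f \<in> ring_hom A B \<inter> extensional (carrier A).
       \<forall>c. \<forall>x\<in>carrier A. f (c \<odot>\<^bsub>A\<^esub> x) = c \<odot>\<^bsub>B\<^esub> f x}"

text \<open>
  A polynomial over \<open>R\<close> in variables indexed by natural numbers is written as a list of terms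
  \<open>(c, [i\<^sub>1, \<dots>, i\<^sub>r])\<close>, standing for \<open>c x\<^bsub>i\<^sub>1\<^esub> \<cdots> x\<^bsub>i\<^sub>r\<^esub>\<close>; \<open>poly_value T h t\<close> is its value at \<open>t\<close> in
  \<open>T\<close>, the coefficients being mapped by \<open>h\<close>.
\<close>

definition poly_value :: "'a calg \<Rightarrow> ('a \<Rightarrow> 'a) \<Rightarrow> (nat \<Rightarrow> 'a) \<Rightarrow> ('a \<times> nat list) list \<Rightarrow> 'a"
  where "poly_value T h t P =
    foldr (\<lambda>(c, is) s. (h c \<otimes>\<^bsub>T\<^esub> foldr (\<lambda>i q. t i \<otimes>\<^bsub>T\<^esub> q) is \<one>\<^bsub>T\<^esub>) \<oplus>\<^bsub>T\<^esub> s) P \<zero>\<^bsub>T\<^esub>"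

text \<open>
  \<open>S\<close> is isomorphic over \<open>R\<close> to a quotient of \<open>R[x\<^sub>0, \<dots>, x\<^bsub>m-1\<^esub>]\<close> by the ideal generated by a finite
  set \<open>\<P>\<close>; the quotient is expressed by its universal property.
\<close>

definition finitely_presented :: "'a calg \<Rightarrow> 'a calg \<Rightarrow> ('a \<Rightarrow> 'a) \<Rightarrow> bool"
  where "finitely_presented R S v \<longleftrightarrow>
    (\<exists>m s \<P>. finite \<P> \<and> s \<in> {..<m} \<rightarrow> carrier S \<and>
       (\<forall>P\<in>\<P>. (\<forall>(c, is)\<in>set P. c \<in> carrier R \<and> set is \<subseteq> {..<m}) \<and> poly_value S v s P = \<zero>\<^bsub>S\<^esub>) \<and>
       (\<forall>T h t. is_calg T \<and> h \<in> calg_hom R T \<and> t \<in> {..<m} \<rightarrow> carrier T \<and>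
          (\<forall>P\<in>\<P>. poly_value T h t P = \<zero>\<^bsub>T\<^esub>) \<longrightarrow>
          (\<exists>!g. g \<in> calg_hom S T \<and> compose (carrier R) g v = h \<and> (\<forall>i<m. g (s i) = t i))))"

text \<open>Unique lifting along surjections \<open>\<pi> : B \<rightarrow> B'\<close> with kernel of square zero.\<close>

definition formally_etale :: "'a calg \<Rightarrow> 'a calg \<Rightarrow> ('a \<Rightarrow> 'a) \<Rightarrow> bool"
  where "formally_etale R S v \<longleftrightarrow>
    (\<forall>B B' \<pi> h q. is_calg B \<and> is_calg B' \<and> \<pi> \<in> calg_hom B B' \<and> \<pi> ` carrier B = carrier B' \<and>
       (\<forall>x\<in>carrier B. \<forall>y\<in>carrier B. \<pi> x = \<zero>\<^bsub>B'\<^esub> \<and> \<pi> y = \<zero>\<^bsub>B'\<^esub> \<longrightarrow> x \<otimes>\<^bsub>B\<^esub> y = \<zero>\<^bsub>B\<^esub>) \<and>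
       h \<in> calg_hom R B \<and> q \<in> calg_hom S B' \<and>
       compose (carrier R) q v = compose (carrier R) \<pi> h \<longrightarrow>
       (\<exists>!l. l \<in> calg_hom S B \<and> compose (carrier R) l v = h \<and> compose (carrier S) \<pi> l = q))"

text \<open>
  \<open>Spec S \<rightarrow> Spec R\<close> is etale and surjective. Since affine schemes are quasi-compact, every etale
  covering of \<open>Spec R\<close> is refined by such a single morphism.
\<close>

definition etale_cover :: "'a calg \<Rightarrow> 'a calg \<Rightarrow> ('a \<Rightarrow> 'a) \<Rightarrow> bool"
  where "etale_cover R S v \<longleftrightarrow>
    is_calg R \<and> is_calg S \<and> v \<in> calg_hom R S \<and>
    finitely_presented R S v \<and> formally_etale R S v \<and>
    (\<forall>\<pp>. primeideal \<pp> R \<longrightarrow> (\<exists>\<qq>. primeideal \<qq> S \<and> {r \<in> carrier R. v r \<in> \<qq>} = \<pp>))"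


section \<open>Quotient stacks\<close>

text \<open>
  A group scheme acting on a scheme, both given by their functors of points on algebras.
\<close>

record ('a, 'g, 'x) group_action_functor =
  grp :: "'a calg \<Rightarrow> 'g monoid"
  grp_map :: "'a calg \<Rightarrow> 'a calg \<Rightarrow> ('a \<Rightarrow> 'a) \<Rightarrow> 'g \<Rightarrow> 'g"
  pts :: "'a calg \<Rightarrow> 'x set"
  pts_map :: "'a calg \<Rightarrow> 'a calg \<Rightarrow> ('a \<Rightarrow> 'a) \<Rightarrow> 'x \<Rightarrow> 'x"
  act :: "'a calg \<Rightarrow> 'g \<Rightarrow> 'x \<Rightarrow> 'x"

text \<open>
  An object of the quotient stack \<open>[X/G]\<close> over \<open>Spec R\<close> is a \<open>G\<close>-torsor \<open>P \<rightarrow> Spec R\<close> with an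
  equivariant morphism \<open>P \<rightarrow> X\<close>. For the affine groups \<open>G\<close> considered below, torsors over affine
  schemes are affine, so \<open>P = Spec A\<close>. The action of \<open>G\<close> on \<open>P\<close> is given on \<open>S\<close>-points, where
  \<open>P(S) = calg_hom A S\<close>, and \<open>P \<rightarrow> X\<close> is given by a point of \<open>X(A)\<close> (Yoneda).
\<close>

record ('a, 'g, 'x) torsor_over =
  base :: "'a calg"
  total :: "'a calg"
  proj :: "'a \<Rightarrow> 'a"
  tact :: "'a calg \<Rightarrow> 'g \<Rightarrow> ('a \<Rightarrow> 'a) \<Rightarrow> ('a \<Rightarrow> 'a)"
  point :: 'x

text \<open>The torsor axioms, without the datum \<open>point\<close>.\<close>

definition is_torsor :: "('a, 'g, 'x) group_action_functor \<Rightarrow> ('a, 'g, 'x) torsor_over \<Rightarrow> bool"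
  where "is_torsor Q t \<longleftrightarrow>
    (let R = base t; A = total t; u = proj t; \<alpha> = tact t in
      is_calg R \<and> is_calg A \<and> u \<in> calg_hom R A \<and>
      (\<forall>S. is_calg S \<longrightarrow>
        (\<forall>p\<in>calg_hom A S.
           \<alpha> S \<one>\<^bsub>grp Q S\<^esub> p = p \<and>
           (\<forall>g\<in>carrier (grp Q S).
              \<alpha> S g p \<in> calg_hom A S \<and>
              compose (carrier R) (\<alpha> S g p) u = compose (carrier R) p u \<and>
              (\<forall>h\<in>carrier (grp Q S). \<alpha> S (g \<otimes>\<^bsub>grp Q S\<^esub> h) p = \<alpha> S g (\<alpha> S h p)) \<and>
              (\<forall>T f. is_calg T \<and> f \<in> calg_hom S T \<longrightarrow>
                 compose (carrier A) f (\<alpha> S g p) =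
                 \<alpha> T (grp_map Q S T f g) (compose (carrier A) f p))) \<and>
           (\<forall>q\<in>calg_hom A S. compose (carrier R) p u = compose (carrier R) q u \<longrightarrow>
              (\<exists>!g. g \<in> carrier (grp Q S) \<and> \<alpha> S g p = q)))) \<and>
      (\<exists>S v p. etale_cover R S v \<and> p \<in> calg_hom A S \<and> compose (carrier R) p u = v))"

definition quotient_obs :: "('a, 'g, 'x) group_action_functor \<Rightarrow> ('a, 'g, 'x) torsor_over set"
  where "quotient_obs Q =
    {t. is_torsor Q t \<and> point t \<in> pts Q (total t) \<and>
        (\<forall>S. is_calg S \<longrightarrow> (\<forall>p\<in>calg_hom (total t) S. \<forall>g\<in>carrier (grp Q S).
           pts_map Q (total t) S (tact t S g p) (point t) =
           act Q S g (pts_map Q (total t) S p (point t))))}"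

text \<open>
  An arrow \<open>t \<rightarrow> t'\<close> is a pair of morphisms \<open>Spec R \<rightarrow> Spec R'\<close> and \<open>P \<rightarrow> P'\<close>, given by the opposite
  algebra homomorphisms \<open>\<phi>\<close> and \<open>\<psi>\<close>, such that \<open>P \<rightarrow> P'\<close> is equivariant and compatible with the
  projections and with the morphisms to \<open>X\<close>. The square formed with the projections is then
  automatically cartesian.
\<close>

definition quotient_homs ::
    "('a, 'g, 'x) group_action_functor \<Rightarrow> ('a, 'g, 'x) torsor_over \<Rightarrow> ('a, 'g, 'x) torsor_over \<Rightarrow>
     (('a \<Rightarrow> 'a) \<times> ('a \<Rightarrow> 'a)) set"
  where "quotient_homs Q t t' =
    {(\<phi>, \<psi>). \<phi> \<in> calg_hom (base t') (base t) \<and> \<psi> \<in> calg_hom (total t') (total t) \<and>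
       compose (carrier (base t')) \<psi> (proj t') = compose (carrier (base t')) (proj t) \<phi> \<and>
       (\<forall>S. is_calg S \<longrightarrow> (\<forall>p\<in>calg_hom (total t) S. \<forall>g\<in>carrier (grp Q S).
          compose (carrier (total t')) (tact t S g p) \<psi> =
          tact t' S g (compose (carrier (total t')) p \<psi>))) \<and>
       pts_map Q (total t') (total t) \<psi> (point t') = point t}"

definition quotient_stack ::
    "('a, 'g, 'x) group_action_functor \<Rightarrow>
     (('a, 'g, 'x) torsor_over, ('a \<Rightarrow> 'a) \<times> ('a \<Rightarrow> 'a), 'a calg, 'a \<Rightarrow> 'a) cat_over"
  where "quotient_stack Q =
    \<lparr>obs = quotient_obs Q,
     homs = quotient_homs Q,
     ident = (\<lambda>t. (\<lambda>r\<in>carrier (base t). r, \<lambda>a\<in>carrier (total t). a)),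
     comp = (\<lambda>t t' t'' (\<phi>', \<psi>') (\<phi>, \<psi>).
       (compose (carrier (base t'')) \<phi> \<phi>', compose (carrier (total t'')) \<psi> \<psi>')),
     pob = base,
     parr = fst\<rparr>"


section \<open>Weighted projective stacks\<close>

text \<open>
  A morphism \<open>Spec S \<rightarrow> \<complex>\<^sup>k - V(J)\<close> is a \<open>k\<close>-tuple of elements of \<open>S\<close> at which the elements of \<open>J\<close>
  generate the unit ideal of \<open>S\<close>. Here \<open>J\<close> is the ideal of the coordinates.
\<close>

definition weighted_action ::
    "nat \<Rightarrow> (nat \<Rightarrow> nat) \<Rightarrow> ('a, 'a, nat \<Rightarrow> 'a) group_action_functor"
  where "weighted_action k w =
    \<lparr>grp = (\<lambda>S. units_of S),
     grp_map = (\<lambda>S T f. f),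
     pts = (\<lambda>S. {x \<in> {1..k} \<rightarrow>\<^sub>E carrier S. Idl\<^bsub>S\<^esub> (x ` {1..k}) = carrier S}),
     pts_map = (\<lambda>S T f x. \<lambda>i\<in>{1..k}. f (x i)),
     act = (\<lambda>S \<mu> x. \<lambda>i\<in>{1..k}. (\<mu> [^]\<^bsub>S\<^esub> w i) \<otimes>\<^bsub>S\<^esub> x i)\<rparr>"

definition weighted_projective_stack ::
    "nat \<Rightarrow> (nat \<Rightarrow> nat) \<Rightarrow>
     (('a, 'a, nat \<Rightarrow> 'a) torsor_over, ('a \<Rightarrow> 'a) \<times> ('a \<Rightarrow> 'a), 'a calg, 'a \<Rightarrow> 'a) cat_over"
  where "weighted_projective_stack k w = quotient_stack (weighted_action k w)"


section \<open>Stacky fans\<close>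

abbreviation Z_pow :: "nat \<Rightarrow> (nat \<Rightarrow> int) monoid"
  where "Z_pow k \<equiv> product_group {1..k} (\<lambda>_. integer_group)"

definition std_basis :: "nat \<Rightarrow> nat \<Rightarrow> nat \<Rightarrow> int"
  where "std_basis k j = (\<lambda>i\<in>{1..k}. if i = j then 1 else 0)"

text \<open>The lattice is \<open>N = \<int>\<^sup>d\<close>, and \<open>N \<otimes> \<rat> = \<rat>\<^sup>d\<close> consists of the functions in \<open>{1..d} \<rightarrow>\<^sub>E UNIV\<close>.\<close>

definition to_Q :: "nat \<Rightarrow> (nat \<Rightarrow> int) \<Rightarrow> nat \<Rightarrow> rat"
  where "to_Q d x = (\<lambda>i\<in>{1..d}. rat_of_int (x i))"

definition cone_gen :: "nat \<Rightarrow> (nat \<Rightarrow> rat) set \<Rightarrow> (nat \<Rightarrow> rat) set"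
  where "cone_gen d V = {(\<lambda>i\<in>{1..d}. \<Sum>v\<in>V. c v * v i) | c. \<forall>v\<in>V. 0 \<le> c v}"

definition lin_indep :: "nat \<Rightarrow> (nat \<Rightarrow> rat) set \<Rightarrow> bool"
  where "lin_indep d V \<longleftrightarrow>
    finite V \<and> V \<subseteq> {1..d} \<rightarrow>\<^sub>E UNIV \<and>
    (\<forall>c. (\<forall>i\<in>{1..d}. (\<Sum>v\<in>V. c v * v i) = 0) \<longrightarrow> (\<forall>v\<in>V. c v = 0))"

definition simplicial_cone :: "nat \<Rightarrow> (nat \<Rightarrow> rat) set \<Rightarrow> bool"
  where "simplicial_cone d \<sigma> \<longleftrightarrow> (\<exists>V. lin_indep d V \<and> \<sigma> = cone_gen d V)"

text \<open>\<open>\<tau>\<close> is cut out of \<open>\<sigma>\<close> by a linear form \<open>m\<close> that is nonnegative on \<open>\<sigma>\<close>.\<close>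

definition face_of_cone :: "nat \<Rightarrow> (nat \<Rightarrow> rat) set \<Rightarrow> (nat \<Rightarrow> rat) set \<Rightarrow> bool"
  where "face_of_cone d \<tau> \<sigma> \<longleftrightarrow>
    (\<exists>m :: nat \<Rightarrow> rat. (\<forall>x\<in>\<sigma>. 0 \<le> (\<Sum>i=1..d. m i * x i)) \<and>
       \<tau> = {x \<in> \<sigma>. (\<Sum>i=1..d. m i * x i) = 0})"

definition simplicial_fan :: "nat \<Rightarrow> (nat \<Rightarrow> rat) set set \<Rightarrow> bool"
  where "simplicial_fan d \<Sigma> \<longleftrightarrow>
    finite \<Sigma> \<and> \<Sigma> \<noteq> {} \<and>
    (\<forall>\<sigma>\<in>\<Sigma>. simplicial_cone d \<sigma>) \<and>
    (\<forall>\<sigma>\<in>\<Sigma>. \<forall>\<tau>. face_of_cone d \<tau> \<sigma> \<longrightarrow> \<tau> \<in> \<Sigma>) \<and>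
    (\<forall>\<sigma>\<in>\<Sigma>. \<forall>\<tau>\<in>\<Sigma>. face_of_cone d (\<sigma> \<inter> \<tau>) \<sigma> \<and> face_of_cone d (\<sigma> \<inter> \<tau>) \<tau>)"

definition fan_rays :: "nat \<Rightarrow> (nat \<Rightarrow> rat) set set \<Rightarrow> (nat \<Rightarrow> rat) set set"
  where "fan_rays d \<Sigma> = {\<sigma> \<in> \<Sigma>. \<exists>v. lin_indep d {v} \<and> \<sigma> = cone_gen d {v}}"

text \<open>The ray spanned by \<open>\<beta>(e\<^sub>i) \<otimes> 1\<close>.\<close>

definition stacky_ray :: "nat \<Rightarrow> nat \<Rightarrow> ((nat \<Rightarrow> int) \<Rightarrow> nat \<Rightarrow> int) \<Rightarrow> nat \<Rightarrow> (nat \<Rightarrow> rat) set"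
  where "stacky_ray d k \<beta> i = cone_gen d {to_Q d (\<beta> (std_basis k i))}"

text \<open>
  The stacky fan \<open>(\<int>\<^sup>d, \<Sigma>, \<beta> : \<int>\<^sup>k \<rightarrow> \<int>\<^sup>d)\<close>. The enumeration \<open>\<rho>\<^sub>1, \<dots>, \<rho>\<^sub>k\<close> of the rays need not be part of
  the data: as \<open>\<beta>(e\<^sub>i) \<otimes> 1\<close> spans \<open>\<rho>\<^sub>i\<close>, it is determined by \<open>\<beta>\<close>.
\<close>

definition stacky_fan ::
    "nat \<Rightarrow> nat \<Rightarrow> (nat \<Rightarrow> rat) set set \<Rightarrow> ((nat \<Rightarrow> int) \<Rightarrow> nat \<Rightarrow> int) \<Rightarrow> bool"
  where "stacky_fan d k \<Sigma> \<beta> \<longleftrightarrow>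
    simplicial_fan d \<Sigma> \<and>
    \<beta> \<in> hom (Z_pow k) (Z_pow d) \<and>
    finite (carrier (Z_pow d Mod (\<beta> ` carrier (Z_pow k)))) \<and>
    bij_betw (stacky_ray d k \<beta>) {1..k} (fan_rays d \<Sigma>)"


section \<open>The toric Deligne-Mumford stack of a stacky fan\<close>

definition hom_group :: "('p, 'r) monoid_scheme \<Rightarrow> ('q, 's) monoid_scheme \<Rightarrow> ('p \<Rightarrow> 'q) monoid"
  where "hom_group M H =
    \<lparr>carrier = hom M H \<inter> extensional (carrier M),
     monoid.mult = (\<lambda>f g. \<lambda>x\<in>carrier M. f x \<otimes>\<^bsub>H\<^esub> g x),
     one = (\<lambda>x\<in>carrier M. \<one>\<^bsub>H\<^esub>)\<rparr>"

abbreviation dual_group :: "('p, 'r) monoid_scheme \<Rightarrow> ('p \<Rightarrow> int) monoid"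
  where "dual_group M \<equiv> hom_group M integer_group"

text \<open>The image of \<open>\<beta>\<^sup>\<star> : N\<^sup>\<star> \<rightarrow> (\<int>\<^sup>k)\<^sup>\<star>\<close>.\<close>

definition dual_image ::
    "nat \<Rightarrow> nat \<Rightarrow> ((nat \<Rightarrow> int) \<Rightarrow> nat \<Rightarrow> int) \<Rightarrow> ((nat \<Rightarrow> int) \<Rightarrow> int) set"
  where "dual_image d k \<beta> =
    (\<lambda>m. compose (carrier (Z_pow k)) m \<beta>) ` carrier (dual_group (Z_pow d))"

definition DG :: "nat \<Rightarrow> nat \<Rightarrow> ((nat \<Rightarrow> int) \<Rightarrow> nat \<Rightarrow> int) \<Rightarrow> ((nat \<Rightarrow> int) \<Rightarrow> int) set monoid"
  where "DG d k \<beta> = dual_group (Z_pow k) Mod dual_image d k \<beta>"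

text \<open>The image in \<open>DG d k \<beta>\<close> of the \<open>i\<close>-th element of the dual basis of \<open>(\<int>\<^sup>k)\<^sup>\<star>\<close>.\<close>

definition DG_gen ::
    "nat \<Rightarrow> nat \<Rightarrow> ((nat \<Rightarrow> int) \<Rightarrow> nat \<Rightarrow> int) \<Rightarrow> nat \<Rightarrow> ((nat \<Rightarrow> int) \<Rightarrow> int) set"
  where "DG_gen d k \<beta> i =
    dual_image d k \<beta> #>\<^bsub>dual_group (Z_pow k)\<^esub> (\<lambda>x\<in>carrier (Z_pow k). x i)"

text \<open>
  The monomial generators of \<open>J\<^sub>\<Sigma>\<close>, evaluated at \<open>x\<close>.
\<close>

definition J_gens ::
    "'a calg \<Rightarrow> nat \<Rightarrow> nat \<Rightarrow> (nat \<Rightarrow> rat) set set \<Rightarrow> ((nat \<Rightarrow> int) \<Rightarrow> nat \<Rightarrow> int) \<Rightarrow> (nat \<Rightarrow> 'a) \<Rightarrow> 'a set"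
  where "J_gens S d k \<Sigma> \<beta> x =
    (\<lambda>\<sigma>. finprod S x {i \<in> {1..k}. \<not> stacky_ray d k \<beta> i \<subseteq> \<sigma>}) ` \<Sigma>"

text \<open>
  \<open>G\<^sub>\<beta>\<close> acting on \<open>Z\<^sub>\<Sigma>\<close>. The \<open>S\<close>-points of the group scheme \<open>G\<^sub>\<beta> = Hom(DG(\<beta>), \<complex>\<^sup>*)\<close> are the homomorphisms
  from \<open>DG(\<beta>)\<close> to the units of \<open>S\<close>.
\<close>

definition toric_action ::
    "nat \<Rightarrow> nat \<Rightarrow> (nat \<Rightarrow> rat) set set \<Rightarrow> ((nat \<Rightarrow> int) \<Rightarrow> nat \<Rightarrow> int) \<Rightarrow>
     ('a, ((nat \<Rightarrow> int) \<Rightarrow> int) set \<Rightarrow> 'a, nat \<Rightarrow> 'a) group_action_functor"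
  where "toric_action d k \<Sigma> \<beta> =
    \<lparr>grp = (\<lambda>S. hom_group (DG d k \<beta>) (units_of S)),
     grp_map = (\<lambda>S T f g. compose (carrier (DG d k \<beta>)) f g),
     pts = (\<lambda>S. {x \<in> {1..k} \<rightarrow>\<^sub>E carrier S. Idl\<^bsub>S\<^esub> (J_gens S d k \<Sigma> \<beta> x) = carrier S}),
     pts_map = (\<lambda>S T f x. \<lambda>i\<in>{1..k}. f (x i)),
     act = (\<lambda>S g x. \<lambda>i\<in>{1..k}. g (DG_gen d k \<beta> i) \<otimes>\<^bsub>S\<^esub> x i)\<rparr>"

definition toric_DM_stack ::
    "nat \<Rightarrow> nat \<Rightarrow> (nat \<Rightarrow> rat) set set \<Rightarrow> ((nat \<Rightarrow> int) \<Rightarrow> nat \<Rightarrow> int) \<Rightarrow>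
     (('a, ((nat \<Rightarrow> int) \<Rightarrow> int) set \<Rightarrow> 'a, nat \<Rightarrow> 'a) torsor_over,
      ('a \<Rightarrow> 'a) \<times> ('a \<Rightarrow> 'a), 'a calg, 'a \<Rightarrow> 'a) cat_over"
  where "toric_DM_stack d k \<Sigma> \<beta> = quotient_stack (toric_action d k \<Sigma> \<beta>)"


section \<open>The matrix, the homomorphism and the fan attached to a weight vector\<close>

definition lam :: "nat \<Rightarrow> (nat \<Rightarrow> nat) \<Rightarrow> nat \<Rightarrow> nat"
  where "lam n w i = Gcd (w ` {i..n+1})"

text \<open>All the divisions are exact.\<close>

definition B_mat :: "nat \<Rightarrow> (nat \<Rightarrow> nat) \<Rightarrow> (nat \<Rightarrow> nat \<Rightarrow> int) \<Rightarrow> nat \<Rightarrow> nat \<Rightarrow> int"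
  where "B_mat n w b i j =
    (if i < n then
       (if j < i then 0
        else if j = i then int (lam n w (i+1) div lam n w i)
        else b i j)
     else
       (if j < n then 0
        else if j = n then int (w (n+1) div lam n w n)
        else - int (w n div lam n w n)))"

text \<open>The homomorphism \<open>\<int>\<^sup>k \<rightarrow> \<int>\<^sup>d\<close> given by the \<open>d \<times> k\<close> matrix \<open>B\<close>.\<close>

definition mat_hom :: "nat \<Rightarrow> nat \<Rightarrow> (nat \<Rightarrow> nat \<Rightarrow> int) \<Rightarrow> (nat \<Rightarrow> int) \<Rightarrow> nat \<Rightarrow> int"
  where "mat_hom d k B = (\<lambda>x\<in>carrier (Z_pow k). \<lambda>i\<in>{1..d}. \<Sum>j=1..k. B i j * x j)"

text \<open>
  The cones generated by any \<open>n\<close> of the \<open>n+1\<close> columns of \<open>B\<close>, together with all their faces.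
\<close>

definition columns_fan :: "nat \<Rightarrow> (nat \<Rightarrow> nat \<Rightarrow> int) \<Rightarrow> (nat \<Rightarrow> rat) set set"
  where "columns_fan n B =
    {\<tau>. \<exists>I \<subseteq> {1..n+1}. card I = n \<and>
         face_of_cone n \<tau> (cone_gen n ((\<lambda>j. to_Q n (\<lambda>i. B i j)) ` I))}"

end

theory Submission
  imports Defs
begin

text \<open>
  The rows of \<open>B\<close> form a basis of the orthogonal complement of \<open>w\<close> in \<open>\<int>\<^sup>n\<^sup>+\<^sup>1\<close>, and this is all that
  is used. Evaluation at \<open>w\<close> therefore identifies \<open>DG(\<beta>)\<close> with \<open>\<int>\<close>, the \<open>i\<close>-th generator going to \<open>w\<^sub>i\<close>,
  so that \<open>G\<^sub>\<beta>\<close> becomes the multiplicative group acting with weights \<open>w\<close>. Dually, the columns of \<open>B\<close>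
  satisfy, up to scaling, only the relation with the positive coefficients \<open>w\<close>; hence the proper
  subsets of the columns are linearly independent and span the cones of a simplicial fan whose
  irrelevant ideal is generated by the coordinates. An isomorphism of group actions induces an
  equivalence of the quotient stacks.
\<close>

section \<open>Isomorphic group actions\<close>

text \<open>The shape of \<open>B\<close> is dictated by integrality. Among the integer vectors
  orthogonal to w that vanish before position i, the i-th entries are exactly the multiples of
  \<lambda>_{i+1} / \<lambda>_i, with \<lambda>_{n+1} read as w_{n+1}. A triangular matrix with this
  diagonal therefore spans the whole complement of w over the integers and not just a sublattice of
  finite index. The condition \<lambda>_1 = 1 makes evaluation at w surjective onto the integers, so
  that the weights come out as w itself and not as a multiple or quotient of it. For the quotient
  stacks the obstacle is that \<open>tact\<close> is a total function of which the torsor axioms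
  restrict only the values at algebras, group elements and points. Carrying a torsor to the other
  group and back may alter the remaining values, so the round trip need not be the identity on
  objects. It is only naturally isomorphic to it, with identity pairs as components.\<close>

lemma calg_hom_id: "(\<lambda>a\<in>carrier A. a) \<in> calg_hom A A" if "is_calg A"
proof -
  interpret algebra "ring_of_type_algebra :: complex ring" A by fact
  show ?thesis
    by (auto simp: calg_hom_def ring_hom_def smult_closed ring_of_type_algebra_def)
qed

lemma compose_calg_hom_id:
  assumes "p \<in> calg_hom A S"
  shows "compose (carrier A) p (\<lambda>a\<in>carrier A. a) = p"
    and "compose (carrier A) (\<lambda>a\<in>carrier S. a) p = p"
proof -
  have "p \<in> extensional (carrier A)" "p ` carrier A \<subseteq> carrier S"
    using assms by (auto simp: calg_hom_def ring_hom_def)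
  then show "compose (carrier A) p (\<lambda>a\<in>carrier A. a) = p"
    and "compose (carrier A) (\<lambda>a\<in>carrier S. a) p = p"
    by (auto simp: compose_def extensional_def fun_eq_iff)
qed

text \<open>Only the groups differ: \<open>pts\<close> agree on algebras and \<open>pts_map\<close>
  agree outright, so the equivariant morphism of a torsor to the scheme can be kept as it
  is.\<close>

locale iso_actions =
  fixes Q :: "('a, 'g, 'x) group_action_functor"
    and Q' :: "('a, 'h, 'x) group_action_functor"
    and \<theta> :: "'a calg \<Rightarrow> 'g \<Rightarrow> 'h"
  assumes group_Q: "is_calg S \<Longrightarrow> group (grp Q S)"
    and group_Q': "is_calg S \<Longrightarrow> group (grp Q' S)"
    and iso_\<theta>: "is_calg S \<Longrightarrow> \<theta> S \<in> iso (grp Q S) (grp Q' S)"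
    and grp_map_closed: "\<lbrakk>is_calg S; is_calg T; f \<in> calg_hom S T; g \<in> carrier (grp Q S)\<rbrakk>
      \<Longrightarrow> grp_map Q S T f g \<in> carrier (grp Q T)"
    and \<theta>_natural: "\<lbrakk>is_calg S; is_calg T; f \<in> calg_hom S T; g \<in> carrier (grp Q S)\<rbrakk>
      \<Longrightarrow> \<theta> T (grp_map Q S T f g) = grp_map Q' S T f (\<theta> S g)"
    and pts_eq: "is_calg S \<Longrightarrow> pts Q' S = pts Q S"
    and pts_map_eq: "pts_map Q' = pts_map Q"
    and pts_map_id: "\<lbrakk>is_calg S; x \<in> pts Q S\<rbrakk> \<Longrightarrow> pts_map Q S S (\<lambda>a\<in>carrier S. a) x = x"
    and act_\<theta>: "\<lbrakk>is_calg S; g \<in> carrier (grp Q S)\<rbrakk> \<Longrightarrow> act Q' S (\<theta> S g) = act Q S g"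
begin

definition \<theta>_inv :: "'a calg \<Rightarrow> 'h \<Rightarrow> 'g"
  where "\<theta>_inv S = inv_into (carrier (grp Q S)) (\<theta> S)"

lemma \<theta>_closed: "is_calg S \<Longrightarrow> g \<in> carrier (grp Q S) \<Longrightarrow> \<theta> S g \<in> carrier (grp Q' S)"
  using iso_\<theta> by (fastforce simp: iso_def hom_def)

lemma \<theta>_bij: "is_calg S \<Longrightarrow> bij_betw (\<theta> S) (carrier (grp Q S)) (carrier (grp Q' S))"
  using iso_\<theta> by (simp add: iso_def)

lemma \<theta>_inv_iso: "is_calg S \<Longrightarrow> \<theta>_inv S \<in> iso (grp Q' S) (grp Q S)"
  unfolding \<theta>_inv_def using group.iso_set_sym group_Q iso_\<theta> by blast

lemma \<theta>_inv_closed: "is_calg S \<Longrightarrow> h \<in> carrier (grp Q' S) \<Longrightarrow> \<theta>_inv S h \<in> carrier (grp Q S)"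
  using \<theta>_inv_iso by (fastforce simp: iso_def hom_def)

lemma \<theta>_inv_\<theta>: "is_calg S \<Longrightarrow> g \<in> carrier (grp Q S) \<Longrightarrow> \<theta>_inv S (\<theta> S g) = g"
  unfolding \<theta>_inv_def using \<theta>_bij bij_betw_inv_into_left by metis

lemma \<theta>_\<theta>_inv: "is_calg S \<Longrightarrow> h \<in> carrier (grp Q' S) \<Longrightarrow> \<theta> S (\<theta>_inv S h) = h"
  unfolding \<theta>_inv_def using \<theta>_bij bij_betw_inv_into_right by metis

text \<open>The situation is symmetric, so every fact about carrying torsors over also serves for
  the way back. Naturality of the inverse comes from writing \<open>h\<close> as
  \<open>\<theta> S (\<theta>_inv S h)\<close>.\<close>

lemma iso_actions_inv: "iso_actions Q' Q \<theta>_inv"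
proof (rule iso_actions.intro)
  fix S T :: "'a calg" and f h
  assume *: "is_calg S" "is_calg T" "f \<in> calg_hom S T" "h \<in> carrier (grp Q' S)"
  have eq: "grp_map Q' S T f h = \<theta> T (grp_map Q S T f (\<theta>_inv S h))"
    using * by (simp add: \<theta>_natural \<theta>_inv_closed \<theta>_\<theta>_inv)
  then show "grp_map Q' S T f h \<in> carrier (grp Q' T)"
    using * by (simp add: \<theta>_closed grp_map_closed \<theta>_inv_closed)
  show "\<theta>_inv T (grp_map Q' S T f h) = grp_map Q S T f (\<theta>_inv S h)"
    using * unfolding eq by (simp add: \<theta>_inv_\<theta> grp_map_closed \<theta>_inv_closed)
next
  fix S :: "'a calg" and h
  assume "is_calg S" "h \<in> carrier (grp Q' S)"
  then show "act Q S (\<theta>_inv S h) = act Q' S h"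
    using act_\<theta>[of S "\<theta>_inv S h"] by (simp add: \<theta>_inv_closed \<theta>_\<theta>_inv)
qed (simp_all add: group_Q group_Q' \<theta>_inv_iso pts_eq pts_map_eq pts_map_id)

text \<open>The new group acts through \<open>\<theta>_inv\<close> and nothing else changes; hence
  arrows can be carried over as the same pairs.\<close>

definition transport :: "('a, 'g, 'x) torsor_over \<Rightarrow> ('a, 'h, 'x) torsor_over"
  where "transport t =
    \<lparr>base = base t, total = total t, proj = proj t,
     tact = (\<lambda>S h. tact t S (\<theta>_inv S h)), point = point t\<rparr>"

lemma transport_simps [simp]:
  "base (transport t) = base t" "total (transport t) = total t" "proj (transport t) = proj t"
  "tact (transport t) S h = tact t S (\<theta>_inv S h)" "point (transport t) = point t"
  by (simp_all add: transport_def)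

lemma is_torsor_transport:
  assumes "is_torsor Q t"
  shows "is_torsor Q' (transport t)"
proof -
  define R A u \<alpha> where "R = base t" "A = total t" "u = proj t" "\<alpha> = tact t"
  note t = assms[unfolded is_torsor_def Let_def, folded R_A_u_\<alpha>_def]
  have calg: "is_calg R" "is_calg A" "u \<in> calg_hom R A"
    and cover: "\<exists>S v p. etale_cover R S v \<and> p \<in> calg_hom A S \<and> compose (carrier R) p u = v"
    using t by blast+
  have one: "\<alpha> S \<one>\<^bsub>grp Q S\<^esub> p = p" if "is_calg S" "p \<in> calg_hom A S" for S p
    using t that by blast
  have closed: "\<alpha> S g p \<in> calg_hom A S"
    and fibre: "compose (carrier R) (\<alpha> S g p) u = compose (carrier R) p u"
    if "is_calg S" "p \<in> calg_hom A S" "g \<in> carrier (grp Q S)" for S p g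
    using t that by blast+
  have mult: "\<alpha> S (g \<otimes>\<^bsub>grp Q S\<^esub> h) p = \<alpha> S g (\<alpha> S h p)"
    if "is_calg S" "p \<in> calg_hom A S" "g \<in> carrier (grp Q S)" "h \<in> carrier (grp Q S)" for S p g h
    using t that by blast
  have natural: "compose (carrier A) f (\<alpha> S g p) = \<alpha> T (grp_map Q S T f g) (compose (carrier A) f p)"
    if "is_calg S" "p \<in> calg_hom A S" "g \<in> carrier (grp Q S)" "is_calg T" "f \<in> calg_hom S T"
    for S T f p g
    using t that by blast
  have simply_transitive: "\<exists>!g. g \<in> carrier (grp Q S) \<and> \<alpha> S g p = q"
    if "is_calg S" "p \<in> calg_hom A S" "q \<in> calg_hom A S"
      "compose (carrier R) p u = compose (carrier R) q u" for S p q
    using t that by blast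
  interpret inv: iso_actions Q' Q \<theta>_inv by (rule iso_actions_inv)
  have inv_one: "\<theta>_inv S \<one>\<^bsub>grp Q' S\<^esub> = \<one>\<^bsub>grp Q S\<^esub>" if "is_calg S" for S
    using \<theta>_inv_iso[OF that] hom_one[OF _ group_Q' group_Q] that by (auto simp: iso_def)
  have inv_mult: "\<theta>_inv S (g \<otimes>\<^bsub>grp Q' S\<^esub> h) = \<theta>_inv S g \<otimes>\<^bsub>grp Q S\<^esub> \<theta>_inv S h"
    if "is_calg S" "g \<in> carrier (grp Q' S)" "h \<in> carrier (grp Q' S)" for S g h
    using \<theta>_inv_iso[OF that(1)] that by (auto simp: iso_def hom_def)
  \<comment> \<open>Bijectivity of \<open>\<theta> S\<close> turns the unique \<open>g\<close> into
    the unique \<open>h\<close> with \<open>\<theta>_inv S h = g\<close>.\<close>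
  have transitive': "\<exists>!h. h \<in> carrier (grp Q' S) \<and> \<alpha> S (\<theta>_inv S h) p = q"
    if "is_calg S" "p \<in> calg_hom A S" "q \<in> calg_hom A S"
      "compose (carrier R) p u = compose (carrier R) q u" for S p q
    using simply_transitive[OF that] \<theta>_closed[OF that(1)] \<theta>_inv_closed[OF that(1)]
      \<theta>_inv_\<theta>[OF that(1)] \<theta>_\<theta>_inv[OF that(1)]
    by metis
  show ?thesis
    unfolding is_torsor_def Let_def transport_simps R_A_u_\<alpha>_def[symmetric]
    using calg cover
    by (intro conjI allI impI ballI)
      (simp_all add: inv_one one closed fibre \<theta>_inv_closed inv_mult mult natural
        inv.\<theta>_natural transitive')
qed

lemma transport_obs: "transport t \<in> quotient_obs Q'" if "t \<in> quotient_obs Q"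
proof -
  interpret inv: iso_actions Q' Q \<theta>_inv by (rule iso_actions_inv)
  have "is_calg (total t)" using that by (auto simp: quotient_obs_def is_torsor_def Let_def)
  then show ?thesis
    using that is_torsor_transport[of t]
    by (simp add: quotient_obs_def pts_eq pts_map_eq \<theta>_inv_closed flip: inv.act_\<theta>)
qed

lemma transport_homs:
  "f \<in> quotient_homs Q' (transport t) (transport t')" if "f \<in> quotient_homs Q t t'"
  using that by (auto simp: quotient_homs_def pts_map_eq \<theta>_inv_closed)

lemma functor_transport:
  "functor_over (quotient_stack Q) (quotient_stack Q') transport (\<lambda>t t' f. f)"
  unfolding functor_over_def quotient_stack_def
  by (auto simp: transport_obs transport_homs)

text \<open>Equivariance is tested only at algebras, group elements and points, so it does not see
  any other values of \<open>tact\<close>.\<close>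

lemma quotient_homs_ident:
  assumes "t \<in> quotient_obs Q" "base t' = base t" "total t' = total t" "proj t' = proj t"
    "point t' = point t"
    and "\<And>S g p. \<lbrakk>is_calg S; g \<in> carrier (grp Q S); p \<in> calg_hom (total t) S\<rbrakk>
      \<Longrightarrow> tact t' S g p = tact t S g p"
  shows "ident (quotient_stack Q) t \<in> quotient_homs Q t t'"
proof -
  have *: "is_calg (base t)" "is_calg (total t)" "proj t \<in> calg_hom (base t) (total t)"
    "point t \<in> pts Q (total t)"
    "\<And>S g p. \<lbrakk>is_calg S; g \<in> carrier (grp Q S); p \<in> calg_hom (total t) S\<rbrakk>
      \<Longrightarrow> tact t S g p \<in> calg_hom (total t) S"
    using assms(1) by (auto simp: quotient_obs_def is_torsor_def Let_def)
  then show ?thesis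
    by (auto simp: quotient_stack_def quotient_homs_def assms calg_hom_id compose_calg_hom_id(2) pts_map_id
        compose_calg_hom_id(1)[OF *(3)] compose_calg_hom_id(1)[OF *(5)] compose_calg_hom_id(1))
qed

end

text \<open>\<open>ident\<close> depends only on the base and total algebras, so the same pair
  serves as component and as its inverse; naturality reduces to the unit laws of
  composition.\<close>

lemma nat_iso_over_ident:
  assumes F: "\<And>t. t \<in> quotient_obs Q \<Longrightarrow> base (F t) = base t \<and> total (F t) = total t"
    and "\<And>t. t \<in> quotient_obs Q \<Longrightarrow> ident (quotient_stack Q) t \<in> quotient_homs Q (F t) t"
    and "\<And>t. t \<in> quotient_obs Q \<Longrightarrow> ident (quotient_stack Q) t \<in> quotient_homs Q t (F t)"
  shows "nat_iso_over (quotient_stack Q) (quotient_stack Q) F (\<lambda>t t' f. f) (\<lambda>t. t) (\<lambda>t t' f. f)"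
  unfolding nat_iso_over_def
proof (intro exI conjI ballI)
  fix t t' f assume *: "t \<in> obs (quotient_stack Q)" "t' \<in> obs (quotient_stack Q)"
    "f \<in> homs (quotient_stack Q) t t'"
  obtain \<phi> \<psi> where f: "f = (\<phi>, \<psi>)" "\<phi> \<in> calg_hom (base t') (base t)" "\<psi> \<in> calg_hom (total t') (total t)"
    using *(3) by (auto simp: quotient_stack_def quotient_homs_def)
  then show "comp (quotient_stack Q) (F t) (F t') t' (ident (quotient_stack Q) t') f =
     comp (quotient_stack Q) (F t) t t' f (ident (quotient_stack Q) t)"
    by (simp add: quotient_stack_def compose_calg_hom_id)
qed (use assms in \<open>auto simp: quotient_stack_def compose_def fun_eq_iff\<close>)

context iso_actions
begin

theorem equivalent_quotient_stacks:
  "equivalent_over (quotient_stack Q) (quotient_stack Q')"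
proof -
  interpret inv: iso_actions Q' Q \<theta>_inv by (rule iso_actions_inv)
  \<comment> \<open>\<open>inv_into\<close> is unspecified outside the image, so the double inverse
    agrees with \<open>\<theta>\<close> only on the carrier.\<close>
  have inv: "inv.\<theta>_inv S g = \<theta> S g" if "is_calg S" "g \<in> carrier (grp Q S)" for S g
    using that by (metis \<theta>_closed \<theta>_inv_\<theta> inv.\<theta>_inv_\<theta>)
  have tact: "tact (transport (inv.transport t)) S g p = tact t S g p"
    if "is_calg S" "g \<in> carrier (grp Q' S)" for t S g p
    using that by (simp add: inv \<theta>_inv_closed \<theta>_\<theta>_inv)
  have tact': "tact (inv.transport (transport t)) S g p = tact t S g p"
    if "is_calg S" "g \<in> carrier (grp Q S)" for t S g p
    using that by (simp add: inv \<theta>_inv_\<theta>)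
  have "nat_iso_over (quotient_stack Q) (quotient_stack Q) (\<lambda>t. inv.transport (transport t))
      (\<lambda>t t' f. f) (\<lambda>t. t) (\<lambda>t t' f. f)"
  proof (rule nat_iso_over_ident)
    fix t assume t: "t \<in> quotient_obs Q"
    show "ident (quotient_stack Q) t \<in> quotient_homs Q t (inv.transport (transport t))"
      using t tact' by (intro quotient_homs_ident) simp_all
    have "ident (quotient_stack Q) (inv.transport (transport t)) \<in> quotient_homs Q (inv.transport (transport t)) t"
      using t tact' by (intro quotient_homs_ident) (simp_all add: transport_obs inv.transport_obs)
    then show "ident (quotient_stack Q) t \<in> quotient_homs Q (inv.transport (transport t)) t"
      by (simp add: quotient_stack_def)
  qed simp
  moreover have "nat_iso_over (quotient_stack Q') (quotient_stack Q') (\<lambda>t. transport (inv.transport t))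
      (\<lambda>t t' f. f) (\<lambda>t. t) (\<lambda>t t' f. f)"
  proof (rule nat_iso_over_ident)
    fix t assume t: "t \<in> quotient_obs Q'"
    show "ident (quotient_stack Q') t \<in> quotient_homs Q' t (transport (inv.transport t))"
      using t tact by (intro inv.quotient_homs_ident) simp_all
    have "ident (quotient_stack Q') (transport (inv.transport t)) \<in> quotient_homs Q' (transport (inv.transport t)) t"
      using t tact by (intro inv.quotient_homs_ident) (simp_all add: transport_obs inv.transport_obs)
    then show "ident (quotient_stack Q') t \<in> quotient_homs Q' (transport (inv.transport t)) t"
      by (simp add: quotient_stack_def)
  qed simp
  ultimately show ?thesis
    unfolding equivalent_over_def using functor_transport inv.functor_transport by blast
qed

end

section \<open>Matrices whose rows span the orthogonal complement of the weights\<close>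

text \<open>Coprimality is stated through a Bezout vector because that vector itself is used: for
  splitting off the complement of \<open>w\<close>, and as a functional with value 1 at
  \<open>w\<close>.\<close>

locale weight_matrix =
  fixes n :: nat and w :: "nat \<Rightarrow> nat" and B :: "nat \<Rightarrow> nat \<Rightarrow> int"
  assumes n_pos: "n \<ge> 1"
    and w_pos: "i \<in> {1..n+1} \<Longrightarrow> w i > 0"
    and coprime_weights: "\<exists>u :: nat \<Rightarrow> int. (\<Sum>j=1..n+1. u j * int (w j)) = 1"
    and B_w: "i \<in> {1..n} \<Longrightarrow> (\<Sum>j=1..n+1. B i j * int (w j)) = 0"
    and rows_span: "(\<Sum>j=1..n+1. y j * int (w j)) = 0 \<Longrightarrow>
      \<exists>m. \<forall>j\<in>{1..n+1}. y j = (\<Sum>i=1..n. m i * B i j)"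
    and rows_indep: "\<forall>j\<in>{1..n+1}. (\<Sum>i=1..n. m i * B i j) = 0 \<Longrightarrow> \<forall>i\<in>{1..n}. m i = 0"
begin

declare sum.cl_ivl_Suc [simp del]

text \<open>
  Splitting \<open>\<int>\<^sup>n\<^sup>+\<^sup>1\<close> as \<open>w\<^sup>\<bottom> \<oplus> \<int>u\<close> with \<open>u \<cdot> w = 1\<close> and expressing the first component in the rows
  of \<open>B\<close> gives a right inverse.
\<close>

lemma right_inverse:
  obtains P where "\<And>i l. i \<in> {1..n} \<Longrightarrow> l \<in> {1..n} \<Longrightarrow> (\<Sum>j=1..n+1. B i j * P j l) = of_bool (i = l)"
proof -
  obtain u :: "nat \<Rightarrow> int" where u: "(\<Sum>j=1..n+1. u j * int (w j)) = 1"
    using coprime_weights by blast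
  have "\<exists>m. \<forall>k\<in>{1..n+1}. of_bool (j = k) - int (w j) * u k = (\<Sum>i=1..n. m i * B i k)"
    if "j \<in> {1..n+1}" for j
  proof (rule rows_span)
    have "(\<Sum>k=1..n+1. (of_bool (j = k) - int (w j) * u k) * int (w k)) =
        (\<Sum>k=1..n+1. (if j = k then int (w k) else 0)) - int (w j) * (\<Sum>k=1..n+1. u k * int (w k))"
      unfolding sum_distrib_left by (subst sum_subtractf[symmetric]) (rule sum.cong, auto simp: algebra_simps)
    then show "(\<Sum>k=1..n+1. (of_bool (j = k) - int (w j) * u k) * int (w k)) = 0"
      unfolding u using that by simp
  qed
  then obtain P where P: "\<And>j k. j \<in> {1..n+1} \<Longrightarrow> k \<in> {1..n+1} \<Longrightarrow>
      of_bool (j = k) - int (w j) * u k = (\<Sum>i=1..n. P j i * B i k)"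
    by metis
  have "(\<Sum>j=1..n+1. B i j * P j l) = of_bool (i = l)" if il: "i \<in> {1..n}" "l \<in> {1..n}" for i l
  proof -
    \<comment> \<open>\<open>B P - I\<close> is killed by right multiplication with
      \<open>B\<close>, because \<open>B\<close> annihilates \<open>w\<close>; independence of the
      rows then allows \<open>B\<close> to be cancelled.\<close>
    have "(\<Sum>l=1..n. ((\<Sum>j=1..n+1. B i j * P j l) - of_bool (i = l)) * B l k) = 0"
      if k: "k \<in> {1..n+1}" for k
    proof -
      have "(\<Sum>l=1..n. (\<Sum>j=1..n+1. B i j * P j l) * B l k) =
          (\<Sum>j=1..n+1. B i j * (\<Sum>l=1..n. P j l * B l k))"
        unfolding sum_distrib_left sum_distrib_right by (subst sum.swap) (simp add: mult.assoc)
      also have "\<dots> = (\<Sum>j=1..n+1. B i j * (of_bool (j = k) - int (w j) * u k))"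
        using P k by (intro sum.cong) auto
      also have "\<dots> = (\<Sum>j=1..n+1. (if j = k then B i j else 0)) - (\<Sum>j=1..n+1. B i j * int (w j)) * u k"
        unfolding sum_distrib_right by (subst sum_subtractf[symmetric]) (rule sum.cong, auto simp: algebra_simps)
      also have "\<dots> = B i k"
        using k il B_w[of i] by simp
      finally have "(\<Sum>l=1..n. (\<Sum>j=1..n+1. B i j * P j l) * B l k) = B i k" .
      moreover have "(\<Sum>l=1..n. of_bool (i = l) * B l k) = B i k"
        using il by (simp add: of_bool_def if_distrib[of "\<lambda>x. x * _"] cong: if_cong)
      ultimately show ?thesis by (simp only: left_diff_distrib sum_subtractf diff_self)
    qed
    then have "\<forall>l\<in>{1..n}. (\<Sum>j=1..n+1. B i j * P j l) - of_bool (i = l) = 0"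
      by (intro rows_indep) blast
    then show ?thesis using il by simp
  qed
  then show ?thesis using that by blast
qed

section \<open>Surjectivity of the homomorphism\<close>

abbreviation \<beta> :: "(nat \<Rightarrow> int) \<Rightarrow> nat \<Rightarrow> int"
  where "\<beta> \<equiv> mat_hom n (n+1) B"

lemma \<beta>_hom: "\<beta> \<in> hom (Z_pow (n+1)) (Z_pow n)"
  by (auto simp: hom_def mat_hom_def fun_eq_iff distrib_left sum.distrib)

text \<open>The integral right inverse \<open>P\<close> gives \<open>P x\<close> as a preimage of
  \<open>x\<close>; the cokernel is thus trivial and not merely finite.\<close>

lemma \<beta>_surj: "\<beta> ` carrier (Z_pow (n+1)) = carrier (Z_pow n)"
proof
  show "\<beta> ` carrier (Z_pow (n+1)) \<subseteq> carrier (Z_pow n)"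
    using \<beta>_hom by (auto simp: hom_def)
  obtain P where P: "\<And>i l. i \<in> {1..n} \<Longrightarrow> l \<in> {1..n} \<Longrightarrow> (\<Sum>j=1..n+1. B i j * P j l) = of_bool (i = l)"
    using right_inverse by blast
  show "carrier (Z_pow n) \<subseteq> \<beta> ` carrier (Z_pow (n+1))"
  proof
    fix x assume x: "x \<in> carrier (Z_pow n)"
    let ?y = "\<lambda>j\<in>{1..n+1}. \<Sum>l=1..n. P j l * x l"
    have "(\<Sum>j=1..n+1. B i j * ?y j) = x i" if i: "i \<in> {1..n}" for i
    proof -
      have "(\<Sum>j=1..n+1. B i j * ?y j) = (\<Sum>j=1..n+1. B i j * (\<Sum>l=1..n. P j l * x l))"
        by (rule sum.cong) auto
      also have "\<dots> = (\<Sum>l=1..n. (\<Sum>j=1..n+1. B i j * P j l) * x l)"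
        unfolding sum_distrib_left sum_distrib_right by (subst sum.swap) (simp add: mult.assoc)
      also have "\<dots> = (\<Sum>l=1..n. of_bool (i = l) * x l)"
        using P i by (intro sum.cong) auto
      also have "\<dots> = x i"
        using i by (simp add: of_bool_def if_distrib[of "\<lambda>x. x * _"] cong: if_cong)
      finally show ?thesis .
    qed
    then have "\<beta> ?y = x"
      using x by (auto simp: mat_hom_def fun_eq_iff PiE_iff extensional_def)
    moreover have "?y \<in> carrier (Z_pow (n+1))" by simp
    ultimately show "x \<in> \<beta> ` carrier (Z_pow (n+1))" by (rule image_eqI[OF sym])
  qed
qed

lemma finite_cokernel: "finite (carrier (Z_pow n Mod (\<beta> ` carrier (Z_pow (n+1)))))"
proof -
  interpret group "Z_pow n" by simp
  have "carrier (Z_pow n Mod carrier (Z_pow n)) \<subseteq> {carrier (Z_pow n)}"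
    unfolding carrier_FactGroup using coset_join2[OF _ subgroup_self] by blast
  then have "finite (carrier (Z_pow n Mod carrier (Z_pow n)))"
    by (rule finite_subset) simp
  then show ?thesis unfolding \<beta>_surj by simp
qed

section \<open>Linear relations among the columns\<close>

definition col :: "nat \<Rightarrow> nat \<Rightarrow> rat"
  where "col j = to_Q n (\<lambda>i. B i j)"

text \<open>Coefficients sit on column indices and not on vectors as in \<open>cone_gen\<close>, so
  that they can be compared with \<open>w\<close> entry by entry.\<close>

definition comb :: "(nat \<Rightarrow> rat) \<Rightarrow> nat \<Rightarrow> rat"
  where "comb c = (\<lambda>i\<in>{1..n}. \<Sum>j=1..n+1. c j * of_int (B i j))"

text \<open>
  The integer relations \<open>w\<^sub>j e\<^sub>i - w\<^sub>i e\<^sub>j\<close> are orthogonal to \<open>w\<close>, hence combinations of the rows of \<open>B\<close>,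
  hence orthogonal to \<open>c\<close>.
\<close>

lemma comb_eq_0_imp_proportional:
  assumes "\<And>l. l \<in> {1..n} \<Longrightarrow> comb c l = 0" and ij: "i \<in> {1..n+1}" "j \<in> {1..n+1}"
  shows "c i * of_nat (w j) = c j * of_nat (w i)"
proof -
  let ?y = "\<lambda>k. of_bool (k = i) * int (w j) - of_bool (k = j) * int (w i)"
  have "(\<Sum>k=1..n+1. ?y k * int (w k)) = 0"
    using ij by (simp add: left_diff_distrib sum_subtractf of_bool_def if_distrib[of "\<lambda>x. x * _"] cong: if_cong)
  then obtain m where m: "\<forall>k\<in>{1..n+1}. ?y k = (\<Sum>l=1..n. m l * B l k)"
    using rows_span[of ?y] by blast
  have "(\<Sum>k=1..n+1. c k * of_int (?y k)) = (\<Sum>k=1..n+1. c k * of_int (\<Sum>l=1..n. m l * B l k))"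
    using m by (intro sum.cong) auto
  also have "\<dots> = (\<Sum>l=1..n. of_int (m l) * (\<Sum>k=1..n+1. c k * of_int (B l k)))"
    unfolding sum_distrib_left of_int_sum by (subst sum.swap) (simp add: algebra_simps)
  also have "\<dots> = (\<Sum>l=1..n. of_int (m l) * comb c l)"
    by (rule sum.cong) (auto simp: comb_def)
  also have "\<dots> = 0" using assms(1) by simp
  finally have "(\<Sum>k=1..n+1. (if k = i then c k * of_nat (w j) else 0)) - (\<Sum>k=1..n+1. (if k = j then c k * of_nat (w i) else 0)) = 0"
    by (subst sum_subtractf[symmetric]) (subst sum.cong[OF refl], auto simp: algebra_simps)
  then show ?thesis using ij by simp
qed

text \<open>The difference \<open>c - d\<close> is a multiple of the positive vector
  \<open>w\<close>, so its entries all have the same sign. It is nonpositive at \<open>i\<close>,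
  where \<open>c\<close> vanishes, and nonnegative at \<open>j\<close>, where \<open>d\<close>
  vanishes; hence it is zero.\<close>

lemma comb_eq_imp_eq:
  assumes "\<And>l. l \<in> {1..n} \<Longrightarrow> comb c l = comb d l"
    and "\<And>j. j \<in> {1..n+1} \<Longrightarrow> 0 \<le> c j" "\<And>j. j \<in> {1..n+1} \<Longrightarrow> 0 \<le> d j"
    and "i \<in> {1..n+1}" "c i = 0" "j \<in> {1..n+1}" "d j = 0" and k: "k \<in> {1..n+1}"
  shows "c k = d k"
proof -
  let ?e = "\<lambda>k. c k - d k"
  have "comb ?e l = 0" if "l \<in> {1..n}" for l
    using assms(1)[OF that] that by (simp add: comb_def left_diff_distrib sum_subtractf)
  then have *: "?e k * of_nat (w l) = ?e l * of_nat (w k)" if "l \<in> {1..n+1}" for l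
    using comb_eq_0_imp_proportional k that by blast
  have "?e i * of_nat (w k) \<le> 0"
    using assms by (intro mult_nonpos_nonneg) auto
  then have "?e k * of_nat (w i) \<le> 0" using *[OF \<open>i \<in> _\<close>] by simp
  then have "?e k \<le> 0" using w_pos[OF \<open>i \<in> _\<close>] by (simp add: mult_le_0_iff)
  moreover have "?e j * of_nat (w k) \<ge> 0"
    using assms by (intro mult_nonneg_nonneg) auto
  then have "?e k * of_nat (w j) \<ge> 0" using *[OF \<open>j \<in> _\<close>] by simp
  then have "?e k \<ge> 0" using w_pos[OF \<open>j \<in> _\<close>] by (simp add: zero_le_mult_iff)
  ultimately show ?thesis by simp
qed

end

section \<open>The fan of the columns\<close>

lemma lin_indepD:
  assumes "lin_indep d V" "\<And>i. i \<in> {1..d} \<Longrightarrow> (\<Sum>v\<in>V. c v * v i) = 0" "v \<in> V"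
  shows "c v = 0"
proof -
  have "(\<forall>i\<in>{1..d}. (\<Sum>v\<in>V. c v * v i) = 0) \<longrightarrow> (\<forall>v\<in>V. c v = 0)"
    using assms(1) unfolding lin_indep_def by (elim conjE allE)
  then show ?thesis using assms(2,3) by simp
qed

section \<open>Cones as images of sets of coefficients\<close>

context weight_matrix
begin

text \<open>Coefficients vanish off \<open>I\<close> on all natural numbers; for proper subsets,
  equal points then have equal coefficient functions, and cones intersect as their supports
  do.\<close>

definition coeffs :: "nat set \<Rightarrow> (nat \<Rightarrow> rat) set"
  where "coeffs I = {c. (\<forall>j. 0 \<le> c j) \<and> (\<forall>j. j \<notin> I \<longrightarrow> c j = 0)}"

definition cone :: "nat set \<Rightarrow> (nat \<Rightarrow> rat) set"
  where "cone I = comb ` coeffs I"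

lemma cone_empty: "cone {} = {comb (\<lambda>_. 0)}"
proof -
  have "coeffs {} = {\<lambda>_. 0}" by (auto simp: coeffs_def)
  then show ?thesis by (simp add: cone_def)
qed

text \<open>Each proper subset omits an index, which supplies the zero entries needed to compare
  \<open>c\<close> and \<open>d\<close>. The two subsets may differ, and this is what makes
  different cones meet in a common face.\<close>

lemma comb_inj:
  assumes "I \<subset> {1..n+1}" "J \<subset> {1..n+1}" "c \<in> coeffs I" "d \<in> coeffs J" "comb c = comb d"
  shows "c = d"
proof
  fix k
  obtain i j where "i \<in> {1..n+1}" "i \<notin> I" "j \<in> {1..n+1}" "j \<notin> J"
    using assms by blast
  then have "c k = d k" if "k \<in> {1..n+1}"
    using comb_eq_imp_eq[of c d i j k] assms that by (simp add: coeffs_def)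
  moreover have "c k = d k" if "k \<notin> {1..n+1}"
  proof -
    have "k \<notin> I" "k \<notin> J" using assms(1,2) that by blast+
    then show ?thesis using assms(3,4) by (simp add: coeffs_def)
  qed
  ultimately show "c k = d k" by blast
qed

text \<open>With n \<ge> 1 there are at least two columns.\<close>

lemma singleton_psubset: "i \<in> {1..n+1} \<Longrightarrow> {i} \<subset> {1..n+1}"
proof (rule psubsetI)
  show "{i} \<noteq> {1..n+1}"
    using n_pos by (auto dest: arg_cong[of _ _ card])
qed simp

lemma of_bool_coeffs: "(\<lambda>j. of_bool (j = i)) \<in> coeffs {i}"
  by (simp add: coeffs_def)

lemma comb_of_bool: "comb (\<lambda>j. of_bool (j = i)) = col i" if "i \<in> {1..n+1}"
  using that by (simp add: comb_def col_def to_Q_def of_bool_def if_distrib[of "\<lambda>x. x * _"] cong: if_cong)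

lemma comb_support:
  assumes "I \<subseteq> {1..n+1}" "\<And>j. j \<notin> I \<Longrightarrow> c j = 0"
  shows "comb c = (\<lambda>i\<in>{1..n}. \<Sum>j\<in>I. c j * col j i)"
proof -
  have "(\<Sum>j=1..n+1. c j * of_int (B i j)) = (\<Sum>j\<in>I. c j * col j i)" if "i \<in> {1..n}" for i
    using assms that by (intro sum.mono_neutral_cong_right) (auto simp: col_def to_Q_def)
  then show ?thesis by (auto simp: comb_def)
qed

lemma inj_on_col: "inj_on col {1..n+1}"
proof (rule inj_onI)
  fix i j assume *: "i \<in> {1..n+1}" "j \<in> {1..n+1}" "col i = col j"
  have "(\<lambda>k. of_bool (k = i) :: rat) = (\<lambda>k. of_bool (k = j))"
    by (rule comb_inj[OF singleton_psubset singleton_psubset of_bool_coeffs of_bool_coeffs, of i j])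
      (simp_all only: comb_of_bool *)
  from fun_cong[OF this, of i] show "i = j" by simp
qed

lemma sum_col_image: "(\<Sum>v\<in>col ` I. c v * v i) = (\<Sum>j\<in>I. c (col j) * col j i)" if "I \<subseteq> {1..n+1}"
  using inj_on_subset[OF inj_on_col that] by (simp add: sum.reindex)

lemma cone_gen_col: "cone_gen n (col ` I) = cone I" if I: "I \<subseteq> {1..n+1}"
proof
  show "cone_gen n (col ` I) \<subseteq> cone I"
  proof
    fix x assume "x \<in> cone_gen n (col ` I)"
    then obtain c where c: "x = (\<lambda>i\<in>{1..n}. \<Sum>v\<in>col ` I. c v * v i)" "\<forall>v\<in>col ` I. 0 \<le> c v"
      by (auto simp: cone_gen_def)
    let ?d = "\<lambda>j. if j \<in> I then c (col j) else 0"
    have "?d \<in> coeffs I" using c(2) by (auto simp: coeffs_def)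
    moreover have "comb ?d = x"
      using I by (simp add: c(1) comb_support[of I] sum_col_image)
    ultimately show "x \<in> cone I" by (auto simp: cone_def)
  qed
  show "cone I \<subseteq> cone_gen n (col ` I)"
  proof
    fix x assume "x \<in> cone I"
    then obtain c where c: "c \<in> coeffs I" "x = comb c" by (auto simp: cone_def)
    let ?d = "\<lambda>v. c (inv_into I col v)"
    have d: "?d (col j) = c j" if "j \<in> I" for j
      using inj_on_subset[OF inj_on_col I] that by simp
    have x: "x = (\<lambda>i\<in>{1..n}. \<Sum>v\<in>col ` I. ?d v * v i)"
      unfolding sum_col_image[OF I] c(2) using c(1) I d
      by (subst comb_support[of I]) (auto simp: coeffs_def intro!: sum.cong restrict_ext)
    have "\<forall>v\<in>col ` I. 0 \<le> ?d v" using c(1) by (auto simp: coeffs_def)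
    then show "x \<in> cone_gen n (col ` I)"
      unfolding cone_gen_def by (intro CollectI exI[of _ ?d] conjI x)
  qed
qed

text \<open>A linear form \<open>m\<close> pulls back along \<open>comb\<close> to the form with
  coefficients \<open>m B\<close>, so faces can be computed on coefficients.\<close>

lemma form_comb:
  "(\<Sum>i=1..n. m i * comb c i) = (\<Sum>j=1..n+1. c j * (\<Sum>i=1..n. m i * of_int (B i j)))"
proof -
  have "(\<Sum>i=1..n. m i * comb c i) = (\<Sum>i=1..n. m i * (\<Sum>j=1..n+1. c j * of_int (B i j)))"
    by (rule sum.cong) (auto simp: comb_def)
  then show ?thesis
    unfolding sum_distrib_left by (subst (asm) sum.swap) (simp add: algebra_simps)
qed

lemma col_in_cone: "col j \<in> cone I" if "j \<in> I" "I \<subseteq> {1..n+1}"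
proof -
  have "(\<lambda>k. of_bool (k = j)) \<in> coeffs I" using that by (auto simp: coeffs_def)
  then show ?thesis using that comb_of_bool[of j] by (force simp: cone_def)
qed

text \<open>A supporting form is nonnegative on each column in \<open>I\<close>. It vanishes on a
  nonnegative combination only if every column that occurs is killed by it, so \<open>J\<close>
  consists of the columns in its kernel.\<close>

lemma face_imp_cone:
  assumes I: "I \<subseteq> {1..n+1}" and face: "face_of_cone n \<tau> (cone I)"
  shows "\<exists>J\<subseteq>I. \<tau> = cone J"
proof -
  obtain m where m: "\<And>x. x \<in> cone I \<Longrightarrow> 0 \<le> (\<Sum>i=1..n. m i * x i)"
    and \<tau>: "\<tau> = {x \<in> cone I. (\<Sum>i=1..n. m i * x i) = 0}"
    using face by (auto simp: face_of_cone_def)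
  define y where "y j = (\<Sum>i=1..n. m i * of_int (B i j))" for j
  have y: "0 \<le> y j" if "j \<in> I" for j
  proof -
    have "y j = (\<Sum>i=1..n. m i * col j i)"
      unfolding y_def by (rule sum.cong) (auto simp: col_def to_Q_def)
    then show ?thesis using m[OF col_in_cone[OF that I]] by simp
  qed
  let ?J = "{j \<in> I. y j = 0}"
  have "(\<Sum>i=1..n. m i * comb c i) = 0 \<longleftrightarrow> c \<in> coeffs ?J" if c: "c \<in> coeffs I" for c
  proof -
    have nonneg: "0 \<le> c j * y j" for j
      using c y[of j] by (cases "j \<in> I") (auto simp: coeffs_def)
    have "(\<Sum>i=1..n. m i * comb c i) = 0 \<longleftrightarrow> (\<Sum>j=1..n+1. c j * y j) = 0"
      unfolding form_comb y_def ..
    also have "\<dots> \<longleftrightarrow> (\<forall>j\<in>{1..n+1}. c j * y j = 0)"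
      by (rule sum_nonneg_eq_0_iff) (simp_all add: nonneg)
    also have "\<dots> \<longleftrightarrow> c \<in> coeffs ?J"
      using c I unfolding coeffs_def by auto
    finally show ?thesis .
  qed
  moreover have "coeffs ?J \<subseteq> coeffs I" by (auto simp: coeffs_def)
  ultimately have "\<tau> = cone ?J"
    unfolding \<tau> cone_def by blast
  moreover have "?J \<subseteq> I" by simp
  ultimately show ?thesis by (intro exI[of _ ?J] conjI)
qed

text \<open>
  For \<open>k \<notin> I\<close>, the vector with entries \<open>w\<^sub>k\<close> on \<open>I - J\<close> and \<open>0\<close> elsewhere except at \<open>k\<close> becomes
  orthogonal to \<open>w\<close> for a suitable entry at \<open>k\<close>; it is then a combination of the rows of \<open>B\<close>, and
  this is the supporting form.
\<close>

lemma cone_face: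
  assumes I: "I \<subset> {1..n+1}" and J: "J \<subseteq> I"
  shows "face_of_cone n (cone J) (cone I)"
proof -
  obtain k where k: "k \<in> {1..n+1}" "k \<notin> I" using I by blast
  define y where "y j = of_bool (j \<in> I - J) * int (w k) - of_bool (j = k) * (\<Sum>j\<in>I - J. int (w j))" for j
  have sum_D: "(\<Sum>j=1..n+1. f j * of_bool (j \<in> I - J)) = (\<Sum>j\<in>I - J. f j)" for f :: "nat \<Rightarrow> 'c::comm_semiring_1"
    using I by (intro sum.mono_neutral_cong_right) auto
  have "(\<Sum>j=1..n+1. y j * int (w j)) = int (w k) * (\<Sum>j=1..n+1. int (w j) * of_bool (j \<in> I - J))
      - (\<Sum>j=1..n+1. if j = k then int (w k) * (\<Sum>j\<in>I - J. int (w j)) else 0)"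
    unfolding y_def
    by (subst sum_distrib_left, subst sum_subtractf[symmetric]) (rule sum.cong, auto simp: algebra_simps)
  also have "\<dots> = 0" unfolding sum_D using k by simp
  finally obtain m where m: "\<forall>j\<in>{1..n+1}. y j = (\<Sum>i=1..n. m i * B i j)"
    using rows_span[of y] by blast
  \<comment> \<open>Since \<open>c k = 0\<close>, the correcting entry of \<open>y\<close> at
    \<open>k\<close> does not contribute.\<close>
  have eq: "(\<Sum>i=1..n. of_int (m i) * comb c i) = of_nat (w k) * (\<Sum>j\<in>I - J. c j)"
    if c: "c \<in> coeffs I" for c
  proof -
    have "(\<Sum>i=1..n. of_int (m i) * of_int (B i j)) = rat_of_int (y j)" if "j \<in> {1..n+1}" for j
      using m that by simp
    then have "(\<Sum>i=1..n. of_int (m i) * comb c i) = (\<Sum>j=1..n+1. c j * of_int (y j))"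
      unfolding form_comb by (intro sum.cong) auto
    also have "\<dots> = (\<Sum>j=1..n+1. of_nat (w k) * (c j * of_bool (j \<in> I - J)))"
      using c k by (intro sum.cong) (auto simp: y_def coeffs_def)
    also have "\<dots> = of_nat (w k) * (\<Sum>j\<in>I - J. c j)"
      unfolding sum_distrib_left[symmetric] sum_D ..
    finally show ?thesis .
  qed
  have fin: "finite (I - J)" using I finite_subset[of I "{1..n+1}"] by auto
  have wk: "rat_of_nat (w k) > 0" using w_pos k by simp
  have iff: "(\<Sum>i=1..n. of_int (m i) * comb c i) = 0 \<longleftrightarrow> c \<in> coeffs J" if c: "c \<in> coeffs I" for c
  proof -
    have "(\<Sum>i=1..n. of_int (m i) * comb c i) = 0 \<longleftrightarrow> (\<Sum>j\<in>I - J. c j) = 0"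
      unfolding eq[OF c] using wk by simp
    also have "\<dots> \<longleftrightarrow> (\<forall>j\<in>I - J. c j = 0)"
      using fin c by (intro sum_nonneg_eq_0_iff) (auto simp: coeffs_def)
    also have "\<dots> \<longleftrightarrow> c \<in> coeffs J" using c by (auto simp: coeffs_def)
    finally show ?thesis .
  qed
  show ?thesis
    unfolding face_of_cone_def
  proof (intro exI conjI ballI)
    fix x assume "x \<in> cone I"
    then obtain c where c: "c \<in> coeffs I" "x = comb c" by (auto simp: cone_def)
    then show "0 \<le> (\<Sum>i=1..n. of_int (m i) * x i)"
      unfolding c(2) eq[OF c(1)] using wk
      by (intro mult_nonneg_nonneg sum_nonneg) (auto simp: coeffs_def)
  next
    have "coeffs J \<subseteq> coeffs I" using J by (auto simp: coeffs_def)
    then show "cone J = {x \<in> cone I. (\<Sum>i=1..n. of_int (m i) * x i) = 0}"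
      unfolding cone_def using iff by blast
  qed
qed

section \<open>The fan and its rays\<close>

abbreviation \<Sigma> :: "(nat \<Rightarrow> rat) set set"
  where "\<Sigma> \<equiv> columns_fan n B"

text \<open>A set of n columns is proper, and so are its subsets; conversely a proper subset misses
  some \<open>k\<close> and lies in the complement of \<open>k\<close>, which has n
  elements.\<close>

lemma columns_fan_eq: "\<Sigma> = {cone J | J. J \<subset> {1..n+1}}"
proof -
  have "\<tau> \<in> \<Sigma> \<longleftrightarrow> (\<exists>I\<subseteq>{1..n+1}. card I = n \<and> face_of_cone n \<tau> (cone I))" for \<tau>
    using cone_gen_col by (auto simp: columns_fan_def simp flip: col_def)
  moreover have "(\<exists>I\<subseteq>{1..n+1}. card I = n \<and> face_of_cone n \<tau> (cone I)) \<longleftrightarrow>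
      (\<exists>J. \<tau> = cone J \<and> J \<subset> {1..n+1})" for \<tau>
  proof
    assume "\<exists>I\<subseteq>{1..n+1}. card I = n \<and> face_of_cone n \<tau> (cone I)"
    then obtain I where I: "I \<subseteq> {1..n+1}" "card I = n" "face_of_cone n \<tau> (cone I)" by blast
    then obtain J where J: "J \<subseteq> I" "\<tau> = cone J" using face_imp_cone by blast
    have "card I \<noteq> card {1..n+1}" using I(2) by simp
    then have "I \<noteq> {1..n+1}" by blast
    then show "\<exists>J. \<tau> = cone J \<and> J \<subset> {1..n+1}" using I(1) J by blast
  next
    assume "\<exists>J. \<tau> = cone J \<and> J \<subset> {1..n+1}"
    then obtain J k where J: "\<tau> = cone J" "J \<subset> {1..n+1}" and k: "k \<in> {1..n+1}" "k \<notin> J" by blast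
    have "card ({1..n+1} - {k}) = n" using k by simp
    moreover have "face_of_cone n \<tau> (cone ({1..n+1} - {k}))"
      unfolding J(1) using J k by (intro cone_face) auto
    ultimately show "\<exists>I\<subseteq>{1..n+1}. card I = n \<and> face_of_cone n \<tau> (cone I)" by blast
  qed
  ultimately show ?thesis by auto
qed

text \<open>By uniqueness of coefficients, \<open>col j\<close> can lie in \<open>cone K\<close>
  only through the indicator function of \<open>j\<close>, which forces
  \<open>j \<in> K\<close>.\<close>

lemma cone_subset_iff: "cone J \<subseteq> cone K \<longleftrightarrow> J \<subseteq> K" if "J \<subset> {1..n+1}" "K \<subset> {1..n+1}"
proof
  assume sub: "cone J \<subseteq> cone K"
  show "J \<subseteq> K"
  proof
    fix j assume j: "j \<in> J"
    then have "col j \<in> cone K" using col_in_cone[of j J] sub that by blast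
    then obtain c where c: "c \<in> coeffs K" "col j = comb c" by (auto simp: cone_def)
    have j1: "j \<in> {1..n+1}" using j that by blast
    have "(\<lambda>k. of_bool (k = j)) = c"
      by (rule comb_inj[OF singleton_psubset that(2) of_bool_coeffs c(1), of j])
        (simp_all only: comb_of_bool j1 c(2))
    then have "c j = 1" by auto
    then show "j \<in> K" using c(1) by (force simp: coeffs_def)
  qed
next
  assume "J \<subseteq> K"
  then show "cone J \<subseteq> cone K" by (auto simp: cone_def coeffs_def)
qed

lemma cone_Int: "cone J \<inter> cone K = cone (J \<inter> K)" if "J \<subset> {1..n+1}" "K \<subset> {1..n+1}"
proof
  show "cone (J \<inter> K) \<subseteq> cone J \<inter> cone K" by (auto simp: cone_def coeffs_def)
  show "cone J \<inter> cone K \<subseteq> cone (J \<inter> K)"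
  proof
    fix x assume "x \<in> cone J \<inter> cone K"
    then obtain c d where *: "c \<in> coeffs J" "d \<in> coeffs K" "x = comb c" "x = comb d"
      by (auto simp: cone_def)
    then have "c = d" using comb_inj that by metis
    then have "c \<in> coeffs (J \<inter> K)" using * by (auto simp: coeffs_def)
    then show "x \<in> cone (J \<inter> K)" using * by (auto simp: cone_def)
  qed
qed

text \<open>A relation among the columns in \<open>J\<close> is proportional to \<open>w\<close>,
  but it is zero at an omitted index, where \<open>w\<close> is positive.\<close>

lemma lin_indep_cols:
  assumes J: "J \<subset> {1..n+1}"
  shows "lin_indep n (col ` J)"
  unfolding lin_indep_def
proof (intro conjI allI impI)
  show "finite (col ` J)" using J finite_subset[of J "{1..n+1}"] by auto
  show "col ` J \<subseteq> {1..n} \<rightarrow>\<^sub>E UNIV" by (auto simp: col_def to_Q_def)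
  fix c assume c: "\<forall>i\<in>{1..n}. (\<Sum>v\<in>col ` J. c v * v i) = 0"
  let ?d = "\<lambda>j. if j \<in> J then c (col j) else 0"
  obtain k where k: "k \<in> {1..n+1}" "k \<notin> J" using J by blast
  have zero: "comb ?d i = 0" if "i \<in> {1..n}" for i
    using c that J by (subst comb_support[of J]) (auto simp: sum_col_image)
  have "c (col j) = 0" if "j \<in> J" for j
  proof -
    have "?d j * of_nat (w k) = ?d k * of_nat (w j)"
      using that J k by (intro comb_eq_0_imp_proportional zero) auto
    then show ?thesis using that k w_pos[of k] by simp
  qed
  then show "\<forall>v\<in>col ` J. c v = 0" by blast
qed

lemma simplicial_fan_\<Sigma>: "simplicial_fan n \<Sigma>"
  unfolding simplicial_fan_def
proof (intro conjI ballI allI impI)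
  have "\<Sigma> = cone ` {J. J \<subset> {1..n+1}}" unfolding columns_fan_eq by auto
  moreover have "finite {J. J \<subset> {1..n+1}}" by (rule finite_subset[of _ "Pow {1..n+1}"]) auto
  ultimately show "finite \<Sigma>" by simp
  show "\<Sigma> \<noteq> {}" unfolding columns_fan_eq using n_pos by (auto intro!: exI[of _ "{}"])
  fix \<sigma> assume "\<sigma> \<in> \<Sigma>"
  then obtain J where J: "J \<subset> {1..n+1}" "\<sigma> = cone J" unfolding columns_fan_eq by blast
  then show "simplicial_cone n \<sigma>"
    unfolding simplicial_cone_def using lin_indep_cols[OF J(1)] cone_gen_col[of J] by auto
  show "\<tau> \<in> \<Sigma>" if "face_of_cone n \<tau> \<sigma>" for \<tau>
  proof -
    have "\<exists>K\<subseteq>J. \<tau> = cone K"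
      using that unfolding J(2) by (rule face_imp_cone[OF psubset_imp_subset[OF J(1)]])
    then obtain K where "K \<subseteq> J" "\<tau> = cone K" by blast
    then show ?thesis unfolding columns_fan_eq using J(1) by blast
  qed
  fix \<tau> assume "\<tau> \<in> \<Sigma>"
  then obtain K where K: "K \<subset> {1..n+1}" "\<tau> = cone K" unfolding columns_fan_eq by blast
  show "face_of_cone n (\<sigma> \<inter> \<tau>) \<sigma>"
    unfolding J(2) K(2) cone_Int[OF J(1) K(1)] by (rule cone_face[OF J(1) Int_lower1])
  show "face_of_cone n (\<sigma> \<inter> \<tau>) \<tau>"
    unfolding J(2) K(2) cone_Int[OF J(1) K(1)] by (rule cone_face[OF K(1) Int_lower2])
qed

lemma stacky_ray_eq: "stacky_ray n (n+1) \<beta> i = cone {i}" if i: "i \<in> {1..n+1}"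
proof -
  have "(\<Sum>j=1..n+1. B l j * std_basis (n+1) i j) = B l i" for l
  proof -
    have "(\<Sum>j=1..n+1. B l j * std_basis (n+1) i j) = (\<Sum>j=1..n+1. if j = i then B l i else 0)"
      by (rule sum.cong) (auto simp: std_basis_def)
    then show ?thesis using i by simp
  qed
  moreover have "std_basis (n+1) i \<in> carrier (Z_pow (n+1))" by (simp add: std_basis_def)
  ultimately have "to_Q n (\<beta> (std_basis (n+1) i)) = col i"
    by (auto simp: to_Q_def col_def mat_hom_def)
  then show ?thesis
    unfolding stacky_ray_def using cone_gen_col[of "{i}"] i by simp
qed

text \<open>All columns in a ray spanned by \<open>v\<close> are multiples of \<open>v\<close>,
  whereas two distinct columns from a proper subset are independent. The empty subset is excluded
  because its cone is zero.\<close>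

lemma fan_rays_\<Sigma>: "fan_rays n \<Sigma> = (\<lambda>i. cone {i}) ` {1..n+1}"
proof
  show "(\<lambda>i. cone {i}) ` {1..n+1} \<subseteq> fan_rays n \<Sigma>"
  proof
    fix \<sigma> assume "\<sigma> \<in> (\<lambda>i. cone {i}) ` {1..n+1}"
    then obtain i where i: "i \<in> {1..n+1}" "\<sigma> = cone {i}" by blast
    then show "\<sigma> \<in> fan_rays n \<Sigma>"
      using singleton_psubset[OF i(1)] lin_indep_cols[of "{i}"] cone_gen_col[of "{i}"]
      unfolding fan_rays_def columns_fan_eq by auto
  qed
  show "fan_rays n \<Sigma> \<subseteq> (\<lambda>i. cone {i}) ` {1..n+1}"
  proof
    fix \<sigma> assume "\<sigma> \<in> fan_rays n \<Sigma>"
    then obtain J v where J: "J \<subset> {1..n+1}" "\<sigma> = cone J" and v: "lin_indep n {v}" "\<sigma> = cone_gen n {v}"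
      unfolding fan_rays_def columns_fan_eq by blast
    have multiple: "\<exists>a. col j = (\<lambda>i\<in>{1..n}. a * v i)" if "j \<in> J" for j
    proof -
      have "col j \<in> cone_gen n {v}" using col_in_cone[OF that] J v(2) by auto
      then show ?thesis by (auto simp: cone_gen_def)
    qed
    have "i = j" if ij: "i \<in> J" "j \<in> J" for i j
    proof (rule ccontr)
      assume "i \<noteq> j"
      obtain a b where ab: "col i = (\<lambda>l\<in>{1..n}. a * v l)" "col j = (\<lambda>l\<in>{1..n}. b * v l)"
        using multiple ij by blast
      have "{i, j} \<subseteq> J" using ij by simp
      then have "{i, j} \<subset> {1..n+1}" using J(1) by (rule subset_psubset_trans)
      then have indep: "lin_indep n {col i, col j}"
        using lin_indep_cols[of "{i, j}"] by simp
      have neq: "col i \<noteq> col j"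
        using inj_onD[OF inj_on_col] ij J(1) \<open>i \<noteq> j\<close> by blast
      have ab_app: "col i l = a * v l" "col j l = b * v l" if "l \<in> {1..n}" for l
        using fun_cong[OF ab(1), of l] fun_cong[OF ab(2), of l] that by simp_all
      have sum2: "(\<Sum>x\<in>{col i, col j}. f x * x l) = f (col i) * col i l + f (col j) * col j l"
        for f :: "_ \<Rightarrow> rat" and l
        using neq by simp
      \<comment> \<open>The relation \<open>b * col i - a * col j = 0\<close> yields
        \<open>a = 0\<close>; then \<open>col i\<close> is zero, which contradicts
        independence.\<close>
      have "(if col j = col i then b else - a) = 0"
        by (rule lin_indepD[OF indep, where c = "\<lambda>x. if x = col i then b else - a"])
          (simp_all add: sum2 ab_app not_sym[OF neq])
      then have "a = 0" using neq by (simp split: if_splits)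
      then have "of_bool (col i = col i) = (0::rat)"
        by (intro lin_indepD[OF indep, where c = "\<lambda>x. of_bool (x = col i)"])
          (simp_all add: sum2 ab_app not_sym[OF neq])
      then show False by simp
    qed
    moreover have "J \<noteq> {}"
    proof
      assume "J = {}"
      have "v \<in> {1..n} \<rightarrow>\<^sub>E UNIV" using v(1) by (simp add: lin_indep_def)
      then have "v = (\<lambda>i\<in>{1..n}. \<Sum>x\<in>{v}. 1 * x i)" by (auto simp: PiE_iff extensional_def)
      then have "v \<in> cone_gen n {v}"
        unfolding cone_gen_def by (intro CollectI exI[of _ "\<lambda>_. 1"] conjI) simp_all
      then have "v = comb (\<lambda>_. 0)"
        unfolding v(2)[symmetric] J(2) \<open>J = {}\<close> cone_empty by simp
      then have "v i = 0" if "i \<in> {1..n}" for i using that by (simp add: comb_def)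
      then show False using lin_indepD[OF v(1), of "\<lambda>_. 1" v] by simp
    qed
    ultimately obtain i where "J = {i}" by blast
    then show "\<sigma> \<in> (\<lambda>i. cone {i}) ` {1..n+1}" using J by blast
  qed
qed

lemma stacky_fan_\<Sigma>: "stacky_fan n (n+1) \<Sigma> \<beta>"
proof -
  have "inj_on (\<lambda>i. cone {i}) {1..n+1}"
  proof (rule inj_onI)
    fix i j assume "i \<in> {1..n+1}" "j \<in> {1..n+1}" "cone {i} = cone {j}"
    then have "{i} \<subseteq> {j}"
      using cone_subset_iff[OF singleton_psubset singleton_psubset, of i j] by simp
    then show "i = j" by simp
  qed
  then have "bij_betw (\<lambda>i. cone {i}) {1..n+1} (fan_rays n \<Sigma>)"
    by (simp add: bij_betw_def fan_rays_\<Sigma>)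
  then have "bij_betw (stacky_ray n (n+1) \<beta>) {1..n+1} (fan_rays n \<Sigma>)"
    by (rule bij_betw_cong[THEN iffD2, rotated]) (rule stacky_ray_eq)
  then show ?thesis
    unfolding stacky_fan_def by (intro conjI simplicial_fan_\<Sigma> \<beta>_hom finite_cokernel)
qed

end

section \<open>The group and the irrelevant ideal\<close>

lemma calg_cring: "is_calg S \<Longrightarrow> cring S"
  by (simp add: algebra_def)

lemma group_hom_group:
  assumes "group M" "comm_group H"
  shows "group (hom_group M H)"
proof -
  interpret M: group M by fact
  interpret H: comm_group H by fact
  show ?thesis
  proof (rule groupI)
    fix f g assume "f \<in> carrier (hom_group M H)" "g \<in> carrier (hom_group M H)"
    then show "f \<otimes>\<^bsub>hom_group M H\<^esub> g \<in> carrier (hom_group M H)"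
      by (auto simp: hom_group_def hom_def Pi_iff H.m_ac)
  next
    fix f g h
    assume "f \<in> carrier (hom_group M H)" "g \<in> carrier (hom_group M H)" "h \<in> carrier (hom_group M H)"
    then show "f \<otimes>\<^bsub>hom_group M H\<^esub> g \<otimes>\<^bsub>hom_group M H\<^esub> h = f \<otimes>\<^bsub>hom_group M H\<^esub> (g \<otimes>\<^bsub>hom_group M H\<^esub> h)"
      by (auto simp: hom_group_def hom_def Pi_iff H.m_assoc intro: restrict_ext)
  next
    show "\<one>\<^bsub>hom_group M H\<^esub> \<in> carrier (hom_group M H)"
      by (auto simp: hom_group_def hom_def)
  next
    fix f assume f: "f \<in> carrier (hom_group M H)"
    then show "\<one>\<^bsub>hom_group M H\<^esub> \<otimes>\<^bsub>hom_group M H\<^esub> f = f"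
      by (auto simp: hom_group_def hom_def Pi_iff extensional_def fun_eq_iff)
    have "(\<lambda>x\<in>carrier M. inv\<^bsub>H\<^esub> f x) \<in> carrier (hom_group M H)"
      using f by (auto simp: hom_group_def hom_def Pi_iff H.inv_mult)
    moreover have "(\<lambda>x\<in>carrier M. inv\<^bsub>H\<^esub> f x) \<otimes>\<^bsub>hom_group M H\<^esub> f = \<one>\<^bsub>hom_group M H\<^esub>"
      using f by (auto simp: hom_group_def hom_def Pi_iff fun_eq_iff)
    ultimately show "\<exists>g\<in>carrier (hom_group M H). g \<otimes>\<^bsub>hom_group M H\<^esub> f = \<one>\<^bsub>hom_group M H\<^esub>"
      by blast
  qed
qed

section \<open>Homomorphisms out of an infinite cyclic group\<close>

locale infinite_cyclic = group D for D (structure) +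
  fixes \<delta> :: "'a \<Rightarrow> int" and \<gamma> :: 'a
  assumes \<delta>_iso: "\<delta> \<in> iso D integer_group"
    and \<gamma>_closed: "\<gamma> \<in> carrier D" and \<delta>_\<gamma>: "\<delta> \<gamma> = 1"
begin

lemma eq_\<gamma>_pow: "d = \<gamma> [^] \<delta> d" if "d \<in> carrier D"
proof -
  have "\<delta> \<in> hom D integer_group" and inj: "inj_on \<delta> (carrier D)"
    using \<delta>_iso by (auto simp: iso_def bij_betw_def)
  then have "\<delta> (\<gamma> [^] \<delta> d) = \<delta> d"
    using hom_int_pow[of \<delta> D integer_group \<gamma> "\<delta> d"] \<gamma>_closed \<delta>_\<gamma> group_axioms by simp
  then show ?thesis using inj that \<gamma>_closed by (auto dest: inj_onD)
qed

lemma hom_eq_pow: "g d = g \<gamma> [^]\<^bsub>H\<^esub> \<delta> d" if "g \<in> hom D H" "group H" "d \<in> carrier D"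
  using hom_int_pow[OF that(1) \<gamma>_closed group_axioms that(2)] eq_\<gamma>_pow[OF that(3)] by metis

text \<open>A homomorphism out of an infinite cyclic group is determined by its value at a
  generator, which is arbitrary. For \<open>H\<close> the units of an algebra, this identifies the
  dual group scheme of the integers with the multiplicative group.\<close>

lemma eval_iso:
  assumes "comm_group H"
  shows "(\<lambda>g. g \<gamma>) \<in> iso (hom_group D H) H"
proof -
  interpret H: comm_group H by fact
  have "inj_on (\<lambda>g. g \<gamma>) (carrier (hom_group D H))"
  proof (rule inj_onI)
    fix f g assume *: "f \<in> carrier (hom_group D H)" "g \<in> carrier (hom_group D H)" "f \<gamma> = g \<gamma>"
    then have "f d = g d" if "d \<in> carrier D" for d
      using hom_eq_pow[of f H d] hom_eq_pow[of g H d] that by (simp add: hom_group_def H.group_axioms)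
    then show "f = g"
      using * by (intro extensionalityI[of f "carrier D" g]) (auto simp: hom_group_def)
  qed
  moreover have "\<mu> \<in> (\<lambda>g. g \<gamma>) ` carrier (hom_group D H)" if "\<mu> \<in> carrier H" for \<mu>
  proof (rule image_eqI[of _ _ "\<lambda>d\<in>carrier D. \<mu> [^]\<^bsub>H\<^esub> \<delta> d"])
    have "\<delta> (x \<otimes> y) = \<delta> x + \<delta> y" if "x \<in> carrier D" "y \<in> carrier D" for x y
      using \<delta>_iso that by (auto simp: iso_def hom_def)
    then show "(\<lambda>d\<in>carrier D. \<mu> [^]\<^bsub>H\<^esub> \<delta> d) \<in> carrier (hom_group D H)"
      using that by (auto simp: hom_group_def hom_def H.int_pow_mult)
  qed (use that \<gamma>_closed \<delta>_\<gamma> in simp)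
  moreover have "(\<lambda>g. g \<gamma>) \<in> hom (hom_group D H) H"
    using \<gamma>_closed by (auto simp: hom_group_def hom_def)
  ultimately show ?thesis by (auto simp: iso_def bij_betw_def hom_def)
qed

end

lemma additive_int: "g a = a * g 1" if "\<And>a b. g (a + b) = g a + g b" for g :: "int \<Rightarrow> int"
proof (induction a rule: int_induct[where k = 0])
  case base then show ?case using that[of 0 0] by simp
next
  case (step1 i) then show ?case by (simp add: that distrib_right)
next
  case (step2 i) then show ?case using that[of "i - 1" 1] by (simp add: left_diff_distrib)
qed

lemma hom_Z_pow_expand:
  assumes f: "f \<in> hom (Z_pow k) integer_group" and x: "x \<in> carrier (Z_pow k)"
  shows "f x = (\<Sum>j=1..k. x j * f (std_basis k j))"
proof -
  have add: "f (\<lambda>i\<in>{1..k}. u i + v i) = f (\<lambda>i\<in>{1..k}. u i) + f (\<lambda>i\<in>{1..k}. v i)" for u v :: "nat \<Rightarrow> int"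
  proof -
    have "f ((\<lambda>i\<in>{1..k}. u i) \<otimes>\<^bsub>Z_pow k\<^esub> (\<lambda>i\<in>{1..k}. v i)) = f (\<lambda>i\<in>{1..k}. u i) \<otimes>\<^bsub>integer_group\<^esub> f (\<lambda>i\<in>{1..k}. v i)"
      by (rule hom_mult[OF f]) auto
    moreover have "(\<lambda>i\<in>{1..k}. u i) \<otimes>\<^bsub>Z_pow k\<^esub> (\<lambda>i\<in>{1..k}. v i) = (\<lambda>i\<in>{1..k}. u i + v i)"
      by auto
    ultimately show ?thesis by simp
  qed
  have scale: "f (\<lambda>i\<in>{1..k}. if i = j then a else 0) = a * f (std_basis k j)" for a j
    unfolding std_basis_def
  proof (rule additive_int)
    show "f (\<lambda>i\<in>{1..k}. if i = j then a + b else 0) =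
        f (\<lambda>i\<in>{1..k}. if i = j then a else 0) + f (\<lambda>i\<in>{1..k}. if i = j then b else 0)" for a b
      unfolding add[symmetric] by (rule arg_cong[of _ _ f]) auto
  qed
  \<comment> \<open>Truncating \<open>x\<close> after position \<open>m\<close> lets an induction
    add one coordinate at a time.\<close>
  have "f (\<lambda>i\<in>{1..k}. if i \<le> m then x i else 0) = (\<Sum>j=1..m. x j * f (std_basis k j))" for m
  proof (induction m)
    case 0
    have "f (\<lambda>i\<in>{1..k}. if i \<le> 0 then x i else 0) = 0 * f (std_basis k 0)"
      unfolding scale[symmetric] by (rule arg_cong[of _ _ f]) auto
    then show ?case by (simp only: mult_zero_left atLeastatMost_empty[OF zero_less_one] sum.empty)
  next
    case (Suc m)
    have "f (\<lambda>i\<in>{1..k}. if i \<le> Suc m then x i else 0) =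
        f (\<lambda>i\<in>{1..k}. (if i \<le> m then x i else 0) + (if i = Suc m then x (Suc m) else 0))"
      by (rule arg_cong[of _ _ f]) (auto simp: le_Suc_eq)
    also have "\<dots> = (\<Sum>j=1..m. x j * f (std_basis k j)) + x (Suc m) * f (std_basis k (Suc m))"
      unfolding add scale Suc ..
    finally show ?case by (simp only: sum.cl_ivl_Suc) simp
  qed
  moreover have "(\<lambda>i\<in>{1..k}. if i \<le> k then x i else 0) = x"
    using x by (auto simp: PiE_iff extensional_def fun_eq_iff)
  ultimately show ?thesis by metis
qed

section \<open>The dual group and the classes of the coordinate functionals\<close>

context weight_matrix
begin

definition at_w :: "((nat \<Rightarrow> int) \<Rightarrow> int) \<Rightarrow> int"
  where "at_w f = f (\<lambda>j\<in>{1..n+1}. int (w j))"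

lemma at_w_group_hom: "group_hom (dual_group (Z_pow (n+1))) integer_group at_w"
proof (intro group_hom.intro group_hom_axioms.intro)
  show "group (dual_group (Z_pow (n+1)))"
    by (intro group_hom_group abelian_integer_group product_group group_integer_group)
  show "at_w \<in> hom (dual_group (Z_pow (n+1))) integer_group"
    by (auto simp: hom_def hom_group_def at_w_def)
qed simp

lemma at_w_surj: "at_w ` carrier (dual_group (Z_pow (n+1))) = carrier integer_group"
proof -
  obtain u :: "nat \<Rightarrow> int" where u: "(\<Sum>j=1..n+1. u j * int (w j)) = 1"
    using coprime_weights by blast
  have "a \<in> at_w ` carrier (dual_group (Z_pow (n+1)))" for a
  proof (rule image_eqI)
    let ?f = "\<lambda>x\<in>carrier (Z_pow (n+1)). a * (\<Sum>j=1..n+1. u j * x j)"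
    show "?f \<in> carrier (dual_group (Z_pow (n+1)))"
      by (auto simp: hom_group_def hom_def distrib_left sum.distrib)
    have "(\<Sum>j=1..n+1. u j * (\<lambda>j\<in>{1..n+1}. int (w j)) j) = 1"
      unfolding u[symmetric] by (rule sum.cong) auto
    then show "a = at_w ?f" by (simp add: at_w_def)
  qed
  then show ?thesis by auto
qed

lemma \<beta>_weights: "\<beta> (\<lambda>j\<in>{1..n+1}. int (w j)) = \<one>\<^bsub>Z_pow n\<^esub>"
proof -
  have "(\<Sum>j=1..n+1. B i j * (\<lambda>j\<in>{1..n+1}. int (w j)) j) = 0" if "i \<in> {1..n}" for i
    unfolding B_w[OF that, symmetric] by (rule sum.cong) auto
  then show ?thesis by (auto simp: mat_hom_def)
qed

text \<open>\<open>\<beta>\<close> kills the weight vector, so functionals pulled back along it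
  vanish there. Conversely, a functional vanishing at \<open>w\<close> has a coordinate vector
  orthogonal to \<open>w\<close>, and the coefficients from \<open>rows_span\<close> form the
  functional of which it is the pullback.\<close>

lemma dual_image_eq: "dual_image n (n+1) \<beta> = kernel (dual_group (Z_pow (n+1))) integer_group at_w"
proof
  show "dual_image n (n+1) \<beta> \<subseteq> kernel (dual_group (Z_pow (n+1))) integer_group at_w"
  proof
    fix f assume "f \<in> dual_image n (n+1) \<beta>"
    then obtain m where m: "m \<in> hom (Z_pow n) integer_group"
      and f: "f = compose (carrier (Z_pow (n+1))) m \<beta>"
      by (auto simp: dual_image_def hom_group_def)
    have "f \<in> hom (Z_pow (n+1)) integer_group"
      unfolding f by (rule group.hom_compose[OF _ \<beta>_hom m]) simp
    moreover have "at_w f = m \<one>\<^bsub>Z_pow n\<^esub>"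
      unfolding at_w_def f using \<beta>_weights by (simp add: compose_def)
    moreover have "m \<one>\<^bsub>Z_pow n\<^esub> = 0"
      using hom_one[OF m] by simp
    ultimately show "f \<in> kernel (dual_group (Z_pow (n+1))) integer_group at_w"
      by (simp add: kernel_def hom_group_def f)
  qed
  show "kernel (dual_group (Z_pow (n+1))) integer_group at_w \<subseteq> dual_image n (n+1) \<beta>"
  proof
    fix f assume "f \<in> kernel (dual_group (Z_pow (n+1))) integer_group at_w"
    then have f: "f \<in> hom (Z_pow (n+1)) integer_group" "f \<in> extensional (carrier (Z_pow (n+1)))" "at_w f = 0"
      by (auto simp: kernel_def hom_group_def)
    let ?y = "\<lambda>j. f (std_basis (n+1) j)"
    have "(\<Sum>j=1..n+1. ?y j * int (w j)) = at_w f"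
      unfolding at_w_def by (subst hom_Z_pow_expand[OF f(1)]) (auto simp: mult.commute intro: sum.cong)
    then obtain m where m: "\<forall>j\<in>{1..n+1}. ?y j = (\<Sum>i=1..n. m i * B i j)"
      using rows_span[of ?y] f(3) by auto
    let ?m = "\<lambda>x\<in>carrier (Z_pow n). \<Sum>i=1..n. m i * x i"
    have "?m \<in> carrier (dual_group (Z_pow n))"
      by (auto simp: hom_group_def hom_def distrib_left sum.distrib)
    moreover have "f = compose (carrier (Z_pow (n+1))) ?m \<beta>"
    proof (rule extensionalityI[OF f(2)])
      fix x assume x: "x \<in> carrier (Z_pow (n+1))"
      then have "\<beta> x \<in> carrier (Z_pow n)" using \<beta>_hom by (auto simp: hom_def)
      then have "compose (carrier (Z_pow (n+1))) ?m \<beta> x = (\<Sum>i=1..n. m i * \<beta> x i)"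
        using x by (simp add: compose_def)
      also have "\<dots> = (\<Sum>i=1..n. m i * (\<Sum>j=1..n+1. B i j * x j))"
        using x by (intro sum.cong) (auto simp: mat_hom_def)
      also have "\<dots> = (\<Sum>j=1..n+1. x j * (\<Sum>i=1..n. m i * B i j))"
        unfolding sum_distrib_left by (subst sum.swap) (simp add: algebra_simps)
      also have "\<dots> = (\<Sum>j=1..n+1. x j * ?y j)"
        using m by (intro sum.cong) auto
      also have "\<dots> = f x"
        using hom_Z_pow_expand[OF f(1) x] by simp
      finally show "f x = compose (carrier (Z_pow (n+1))) ?m \<beta> x" ..
    qed (simp add: compose_def)
    ultimately show "f \<in> dual_image n (n+1) \<beta>" unfolding dual_image_def by blast
  qed
qed

abbreviation D :: "((nat \<Rightarrow> int) \<Rightarrow> int) set monoid"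
  where "D \<equiv> DG n (n+1) \<beta>"

text \<open>The map of the first isomorphism theorem: \<open>at_w\<close> is constant on each coset
  of its kernel, and \<open>the_elem\<close> extracts the value.\<close>

definition \<delta> :: "((nat \<Rightarrow> int) \<Rightarrow> int) set \<Rightarrow> int"
  where "\<delta> C = the_elem (at_w ` C)"

definition \<gamma> :: "((nat \<Rightarrow> int) \<Rightarrow> int) set"
  where "\<gamma> = inv_into (carrier D) \<delta> 1"

lemma group_D: "group D"
proof -
  interpret group_hom "dual_group (Z_pow (n+1))" integer_group at_w by (rule at_w_group_hom)
  show ?thesis unfolding DG_def dual_image_eq by (rule normal.factorgroup_is_group[OF normal_kernel])
qed

lemma \<delta>_iso: "\<delta> \<in> iso D integer_group"
proof -
  interpret group_hom "dual_group (Z_pow (n+1))" integer_group at_w by (rule at_w_group_hom)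
  have "(\<lambda>C. the_elem (at_w ` C)) \<in> iso D integer_group"
    unfolding DG_def dual_image_eq by (rule FactGroup_iso_set[OF at_w_surj])
  then show ?thesis by (simp add: \<delta>_def[abs_def])
qed

sublocale infinite_cyclic D \<delta> \<gamma>
proof (rule infinite_cyclic.intro[OF group_D], rule infinite_cyclic_axioms.intro[OF \<delta>_iso])
  have *: "1 \<in> \<delta> ` carrier D" using \<delta>_iso by (simp add: iso_def bij_betw_def)
  show "\<gamma> \<in> carrier D" unfolding \<gamma>_def by (rule inv_into_into[OF *])
  show "\<delta> \<gamma> = 1" unfolding \<gamma>_def by (rule f_inv_into_f[OF *])
qed

text \<open>The weights enter here, as the values of the coordinate functionals at
  \<open>w\<close>.\<close>

lemma DG_gen:
  assumes i: "i \<in> {1..n+1}"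
  shows DG_gen_closed: "DG_gen n (n+1) \<beta> i \<in> carrier D"
    and \<delta>_DG_gen: "\<delta> (DG_gen n (n+1) \<beta> i) = int (w i)"
proof -
  interpret group_hom "dual_group (Z_pow (n+1))" integer_group at_w by (rule at_w_group_hom)
  let ?e = "\<lambda>x\<in>carrier (Z_pow (n+1)). x i"
  let ?K = "kernel (dual_group (Z_pow (n+1))) integer_group at_w"
  have e: "?e \<in> carrier (dual_group (Z_pow (n+1)))"
    using i by (auto simp: hom_group_def hom_def)
  then show "DG_gen n (n+1) \<beta> i \<in> carrier D"
    unfolding DG_gen_def DG_def carrier_FactGroup dual_image_eq by blast
  have UN_constant: "(\<Union>x\<in>A. {h x}) = {c}" if "\<And>x. x \<in> A \<Longrightarrow> h x = c" "a \<in> A"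
    for A :: "((nat \<Rightarrow> int) \<Rightarrow> int) set" and h and c :: int and a
    using that by auto
  have "at_w ?e = int (w i)" using i by (simp add: at_w_def)
  then have "at_w (f \<otimes>\<^bsub>dual_group (Z_pow (n+1))\<^esub> ?e) = int (w i)" if "f \<in> ?K" for f
    using that hom_mult[of f ?e] e by (simp add: kernel_def)
  moreover have "\<one>\<^bsub>dual_group (Z_pow (n+1))\<^esub> \<in> ?K"
    using subgroup_kernel by (rule subgroup.one_closed)
  ultimately have "at_w ` (?K #>\<^bsub>dual_group (Z_pow (n+1))\<^esub> ?e) = {int (w i)}"
    unfolding r_coset_def image_UN image_insert image_empty by (rule UN_constant)
  then show "\<delta> (DG_gen n (n+1) \<beta> i) = int (w i)"
    unfolding DG_gen_def dual_image_eq \<delta>_def by simp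
qed

section \<open>The irrelevant ideal\<close>

lemma J_gens_eq:
  "J_gens S n (n+1) \<Sigma> \<beta> x = {finprod S x ({1..n+1} - J) | J. J \<subset> {1..n+1}}"
proof -
  have "{i \<in> {1..n+1}. \<not> stacky_ray n (n+1) \<beta> i \<subseteq> cone J} = {1..n+1} - J" if "J \<subset> {1..n+1}" for J
  proof -
    have "stacky_ray n (n+1) \<beta> i \<subseteq> cone J \<longleftrightarrow> i \<in> J" if "i \<in> {1..n+1}" for i
      unfolding stacky_ray_eq[OF that] using cone_subset_iff[OF singleton_psubset[OF that] \<open>J \<subset> _\<close>] by simp
    then show ?thesis by blast
  qed
  then have "J_gens S n (n+1) \<Sigma> \<beta> x = (\<lambda>J. finprod S x ({1..n+1} - J)) ` {J. J \<subset> {1..n+1}}"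
    unfolding J_gens_def columns_fan_eq setcompr_eq_image image_image by (intro image_cong) auto
  then show ?thesis by (simp only: setcompr_eq_image)
qed

text \<open>Every generator is a product over a nonempty set of coordinates, hence a multiple of one
  of them; the subsets omitting a single index, that is, the maximal cones, give back the
  coordinates themselves.\<close>

lemma Idl_J_gens:
  assumes "cring S" and x: "x \<in> {1..n+1} \<rightarrow> carrier S"
  shows "Idl\<^bsub>S\<^esub> (J_gens S n (n+1) \<Sigma> \<beta> x) = Idl\<^bsub>S\<^esub> (x ` {1..n+1})"
proof -
  interpret cring S by fact
  have sub: "x ` {1..n+1} \<subseteq> carrier S" using x by blast
  have "J_gens S n (n+1) \<Sigma> \<beta> x \<subseteq> Idl\<^bsub>S\<^esub> (x ` {1..n+1})"
  proof
    fix a assume "a \<in> J_gens S n (n+1) \<Sigma> \<beta> x"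
    then obtain J k where J: "a = finprod S x ({1..n+1} - J)" "k \<in> {1..n+1} - J"
      unfolding J_gens_eq by blast
    let ?K = "{1..n+1} - J - {k}"
    have K: "finite ?K" "x \<in> ?K \<rightarrow> carrier S" "x k \<in> carrier S" using x J(2) by auto
    have "finprod S x (insert k ?K) = x k \<otimes>\<^bsub>S\<^esub> finprod S x ?K"
      using K by (intro finprod_insert) auto
    moreover have "insert k ?K = {1..n+1} - J" using J(2) by blast
    ultimately have "a = x k \<otimes>\<^bsub>S\<^esub> finprod S x ?K" unfolding J(1) by simp
    moreover have "x k \<in> Idl\<^bsub>S\<^esub> (x ` {1..n+1})"
      using genideal_self[OF sub] J(2) by blast
    ultimately show "a \<in> Idl\<^bsub>S\<^esub> (x ` {1..n+1})"
      using ideal.I_r_closed[OF genideal_ideal[OF sub]] finprod_closed[OF K(2)] by simp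
  qed
  moreover have "x ` {1..n+1} \<subseteq> J_gens S n (n+1) \<Sigma> \<beta> x"
  proof
    fix a assume "a \<in> x ` {1..n+1}"
    then obtain k where k: "k \<in> {1..n+1}" "a = x k" by blast
    have proper: "{1..n+1} - {k} \<subset> {1..n+1}" and "{1..n+1} - ({1..n+1} - {k}) = {k}"
      using k(1) by blast+
    then have "finprod S x ({1..n+1} - ({1..n+1} - {k})) = x k"
      using x k(1) by (simp add: Pi_iff)
    then show "a \<in> J_gens S n (n+1) \<Sigma> \<beta> x"
      unfolding J_gens_eq k(2)
      by (intro CollectI exI[of _ "{1..n+1} - {k}"] conjI proper) (rule sym)
  qed
  moreover have "J_gens S n (n+1) \<Sigma> \<beta> x \<subseteq> carrier S"
    unfolding J_gens_eq using x by (auto intro!: finprod_closed)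
  ultimately show ?thesis
    using sub genideal_minimal genideal_ideal genideal_self by (meson subset_antisym subset_trans)
qed

end

section \<open>Matching the toric action with the weighted one\<close>

lemma calg_hom_units:
  assumes "is_calg S" "is_calg T" "f \<in> calg_hom S T"
  shows "f \<in> hom (units_of S) (units_of T)"
proof -
  interpret S: cring S by (rule calg_cring) fact
  interpret T: cring T by (rule calg_cring) fact
  have f: "f \<in> ring_hom S T" using assms(3) by (simp add: calg_hom_def)
  have "f x \<in> Units T" if x: "x \<in> Units S" for x
  proof -
    obtain y where y: "y \<in> carrier S" "y \<otimes>\<^bsub>S\<^esub> x = \<one>\<^bsub>S\<^esub>" "x \<otimes>\<^bsub>S\<^esub> y = \<one>\<^bsub>S\<^esub>" "x \<in> carrier S"
      using x by (auto simp: Units_def)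
    then have "f y \<otimes>\<^bsub>T\<^esub> f x = \<one>\<^bsub>T\<^esub>" "f x \<otimes>\<^bsub>T\<^esub> f y = \<one>\<^bsub>T\<^esub>"
      by (simp_all add: ring_hom_one[OF f] flip: ring_hom_mult[OF f])
    then show ?thesis using y ring_hom_closed[OF f] by (auto simp: Units_def)
  qed
  then show ?thesis using ring_hom_mult[OF f] by (auto simp: hom_def units_of_def)
qed

context weight_matrix
begin

lemma iso_actions_toric_weighted:
  "iso_actions (toric_action n (n+1) \<Sigma> \<beta>) (weighted_action (n+1) w) (\<lambda>S g. g \<gamma>)"
proof (rule iso_actions.intro)
  fix S :: "'a calg" assume S: "is_calg S"
  interpret S: cring S using S by (rule calg_cring)
  have units: "comm_group (units_of S)" by (rule S.units_comm_group)
  show "group (grp (toric_action n (n+1) \<Sigma> \<beta>) S)"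
    unfolding toric_action_def by (simp add: group_hom_group[OF group_D units, simplified])
  show "group (grp (weighted_action (n+1) w) S)"
    unfolding weighted_action_def by (simp add: S.units_group)
  show "(\<lambda>g. g \<gamma>) \<in> iso (grp (toric_action n (n+1) \<Sigma> \<beta>) S) (grp (weighted_action (n+1) w) S)"
    unfolding toric_action_def weighted_action_def using eval_iso[OF units] by simp
  have "Idl\<^bsub>S\<^esub> (J_gens S n (n+1) \<Sigma> \<beta> x) = Idl\<^bsub>S\<^esub> (x ` {1..n+1})" if "x \<in> {1..n+1} \<rightarrow>\<^sub>E carrier S" for x
    using that by (intro Idl_J_gens S.is_cring) auto
  then show "pts (weighted_action (n+1) w) S = pts (toric_action n (n+1) \<Sigma> \<beta>) S"
    unfolding toric_action_def weighted_action_def by auto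
  show "pts_map (toric_action n (n+1) \<Sigma> \<beta>) S S (\<lambda>a\<in>carrier S. a) x = x"
    if "x \<in> pts (toric_action n (n+1) \<Sigma> \<beta>) S" for x
    using that by (auto simp: toric_action_def PiE_iff extensional_def fun_eq_iff)
  fix g assume "g \<in> carrier (grp (toric_action n (n+1) \<Sigma> \<beta>) S)"
  then have g: "g \<in> hom D (units_of S)" by (simp add: toric_action_def hom_group_def)
  then have "g \<gamma> \<in> Units S" using \<gamma>_closed by (auto simp: hom_def units_of_def)
  \<comment> \<open>In \<open>D\<close> the i-th generator is the power of \<open>\<gamma>\<close>
    with exponent \<open>w i\<close>, and \<open>g\<close> preserves powers.\<close>
  then have "g (DG_gen n (n+1) \<beta> i) = g \<gamma> [^]\<^bsub>S\<^esub> w i" if "i \<in> {1..n+1}" for i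
    using hom_eq_pow[OF g S.units_group DG_gen_closed[OF that]]
    unfolding \<delta>_DG_gen[OF that] int_pow_int by (simp add: S.units_of_pow)
  then show "act (weighted_action (n+1) w) S (g \<gamma>) = act (toric_action n (n+1) \<Sigma> \<beta>) S g"
    by (auto simp: toric_action_def weighted_action_def fun_eq_iff)
next
  fix S T :: "'a calg" and f g
  assume *: "is_calg S" "is_calg T" "f \<in> calg_hom S T"
    "g \<in> carrier (grp (toric_action n (n+1) \<Sigma> \<beta>) S)"
  have "compose (carrier D) f g \<in> hom D (units_of T)"
    using *(4) calg_hom_units[OF *(1-3)]
    by (intro group.hom_compose[OF group_D, of g]) (auto simp: toric_action_def hom_group_def)
  then show "grp_map (toric_action n (n+1) \<Sigma> \<beta>) S T f g \<in> carrier (grp (toric_action n (n+1) \<Sigma> \<beta>) T)"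
    by (simp add: toric_action_def hom_group_def)
  show "grp_map (toric_action n (n+1) \<Sigma> \<beta>) S T f g \<gamma> = grp_map (weighted_action (n+1) w) S T f (g \<gamma>)"
    using \<gamma>_closed by (simp add: toric_action_def weighted_action_def compose_def)
qed (simp add: toric_action_def weighted_action_def)

end

section \<open>The triangular matrix\<close>

lemma bezout_Gcd:
  fixes w :: "nat \<Rightarrow> nat"
  assumes "finite A"
  shows "\<exists>u :: nat \<Rightarrow> int. (\<Sum>j\<in>A. u j * int (w j)) = int (Gcd (w ` A))"
  using assms
proof (induction A rule: finite_induct)
  case (insert a A)
  then obtain u :: "nat \<Rightarrow> int" where u: "(\<Sum>j\<in>A. u j * int (w j)) = int (Gcd (w ` A))" by blast
  obtain p q where pq: "p * int (w a) + q * int (Gcd (w ` A)) = gcd (int (w a)) (int (Gcd (w ` A)))"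
    using bezout_int by blast
  have "(\<Sum>j\<in>insert a A. (if j = a then p else q * u j) * int (w j)) =
      p * int (w a) + (\<Sum>j\<in>A. q * (u j * int (w j)))"
    using insert.hyps by (auto intro!: arg_cong2[of _ _ _ _ "(+)"] sum.cong)
  also have "\<dots> = int (Gcd (w ` insert a A))"
    unfolding sum_distrib_left[symmetric] u pq by simp
  finally show ?case by (rule exI[of _ "\<lambda>j. if j = a then p else q * u j"])
qed simp

text \<open>\<open>c\<close> divides both \<open>y * a\<close> and \<open>y * c\<close>, hence also
  \<open>y * gcd a c\<close>.\<close>

lemma dvd_mult_imp_div_gcd_dvd:
  fixes a c y :: int
  assumes "c dvd y * a" "c \<noteq> 0"
  shows "c div gcd a c dvd y"
proof -
  have "c dvd gcd (a * y) (c * y)" using assms(1) by (simp add: mult.commute)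
  then have "c dvd y * gcd a c" by (simp add: gcd_mult_right gcd.commute mult.commute)
  then show ?thesis using assms(2) by (simp add: div_dvd_iff_mult)
qed

lemma lam_Suc: "lam n w i = gcd (w i) (lam n w (Suc i))" if "i \<le> n"
proof -
  have "{i..n+1} = insert i {Suc i..n+1}" using that by auto
  then show ?thesis by (simp add: lam_def)
qed

lemma lam_last: "lam n w (Suc n) = w (Suc n)"
  by (simp add: lam_def)

lemma lam_dvd: "lam n w i dvd w j" if "j \<in> {i..n+1}"
  using that by (auto simp: lam_def)

lemma lam_pos: "lam n w i > 0" if "i \<in> {1..n+1}" "w i > 0"
  using that by (intro dvd_pos_nat[OF _ lam_dvd]) auto

text \<open>As \<open>lam\<close> also makes sense at n + 1, with value w_{n+1}, the last row
  follows the same diagonal pattern and elimination can treat all rows alike.\<close>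

lemma B_mat_diag: "B_mat n w b i i = int (lam n w (Suc i) div lam n w i)" if "i \<in> {1..n}"
  using that by (auto simp: B_mat_def lam_last less_le)

lemma B_mat_lower: "B_mat n w b i j = 0" if "j < i" "i \<in> {1..n}"
  using that by (auto simp: B_mat_def)

lemma B_mat_weights:
  assumes i: "i \<in> {1..n}"
    and b: "\<forall>i\<in>{1..n-1}. int (lam n w (i+1) div lam n w i) * int (w i)
           + (\<Sum>j=i+1..n+1. b i j * int (w j)) = 0"
  shows "(\<Sum>j=1..n+1. B_mat n w b i j * int (w j)) = 0"
proof -
  have "(\<Sum>j=1..n+1. B_mat n w b i j * int (w j)) = (\<Sum>j=i..n+1. B_mat n w b i j * int (w j))"
    using i by (intro sum.mono_neutral_right) (auto simp: B_mat_lower)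
  also have "\<dots> = B_mat n w b i i * int (w i) + (\<Sum>j=i+1..n+1. B_mat n w b i j * int (w j))"
    using i by (subst sum.atLeast_Suc_atMost) auto
  also have "\<dots> = 0"
  proof (cases "i = n")
    case True
    \<comment> \<open>In the last row the two terms are w_n w_{n+1} / \<lambda>_n with opposite
      signs.\<close>
    obtain p q where "w n = lam n w n * p" "w (Suc n) = lam n w n * q"
      using lam_dvd[of n n n w] lam_dvd[of "Suc n" n n w] by (auto elim!: dvdE)
    then show ?thesis
      using True i by (cases "lam n w n = 0") (auto simp: B_mat_def mult.commute mult.left_commute)
  next
    case False
    then have "(\<Sum>j=i+1..n+1. B_mat n w b i j * int (w j)) = (\<Sum>j=i+1..n+1. b i j * int (w j))"
      using i by (intro sum.cong) (auto simp: B_mat_def)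
    moreover have "i \<in> {1..n-1}" using i False by auto
    ultimately show ?thesis
      using b[rule_format, of i] i by (simp add: B_mat_diag del: sum.cl_ivl_Suc)
  qed
  finally show ?thesis .
qed

text \<open>
  Elimination from the left: if \<open>y\<close> vanishes before position \<open>i\<close>, then \<open>\<lambda>\<^bsub>i+1\<^esub>\<close> divides \<open>y\<^sub>i w\<^sub>i\<close>, so
  the diagonal entry \<open>\<lambda>\<^bsub>i+1\<^esub> / \<lambda>\<^sub>i\<close> divides \<open>y\<^sub>i\<close>.
\<close>

lemma B_mat_rows_span:
  assumes w: "\<forall>i\<in>{1..n+1}. w i > 0"
    and B_w: "\<And>i. i \<in> {1..n} \<Longrightarrow> (\<Sum>j=1..n+1. B_mat n w b i j * int (w j)) = 0"
    and i: "1 \<le> i" "i \<le> Suc n"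
    and y: "\<And>j. 1 \<le> j \<Longrightarrow> j < i \<Longrightarrow> y j = 0" "(\<Sum>j=1..n+1. y j * int (w j)) = 0"
  shows "\<exists>m. \<forall>j\<in>{1..n+1}. y j = (\<Sum>i=1..n. m i * B_mat n w b i j)"
  using i(2) y
proof (induction i arbitrary: y rule: inc_induct)
  case base
  \<comment> \<open>Only the last entry of \<open>y\<close> can still be nonzero, and
    \<open>w\<close> is positive there.\<close>
  have "(\<Sum>j=1..n+1. y j * int (w j)) = y (Suc n) * int (w (Suc n))"
    using base(1) by simp
  moreover have "w (Suc n) > 0" using w by simp
  ultimately have "y (Suc n) = 0" unfolding base(2) by simp
  then have "\<forall>j\<in>{1..n+1}. y j = 0" using base(1) by (auto simp: le_Suc_eq)
  then show ?case by (intro exI[of _ "\<lambda>_. 0"]) simp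
next
  case (step k)
  have k: "k \<in> {1..n}" using step.hyps i by auto
  let ?B = "B_mat n w b"
  have "(\<Sum>j=1..n+1. y j * int (w j)) = (\<Sum>j=k..n+1. y j * int (w j))"
    using k step.prems(1) by (intro sum.mono_neutral_right) auto
  also have "\<dots> = y k * int (w k) + (\<Sum>j=Suc k..n+1. y j * int (w j))"
    using k by (subst sum.atLeast_Suc_atMost) auto
  finally have "y k * int (w k) = - (\<Sum>j=Suc k..n+1. y j * int (w j))"
    using step.prems(2) by linarith
  moreover have "int (lam n w (Suc k)) dvd (\<Sum>j=Suc k..n+1. y j * int (w j))"
    using lam_dvd by (intro dvd_sum dvd_mult) auto
  ultimately have "int (lam n w (Suc k)) dvd y k * int (w k)" by simp
  moreover have "lam n w (Suc k) > 0" using w k by (intro lam_pos) auto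
  ultimately have "int (lam n w (Suc k)) div gcd (int (w k)) (int (lam n w (Suc k))) dvd y k"
    by (intro dvd_mult_imp_div_gcd_dvd) auto
  then have "?B k k dvd y k"
    using k by (simp add: B_mat_diag lam_Suc[of k] zdiv_int)
  then obtain t where t: "y k = ?B k k * t" by blast
  \<comment> \<open>Subtracting \<open>t\<close> times row \<open>k\<close> clears position
    \<open>k\<close> and preserves orthogonality to \<open>w\<close>.\<close>
  let ?y = "\<lambda>j. y j - t * ?B k j"
  have "(\<Sum>j=1..n+1. ?y j * int (w j)) =
      (\<Sum>j=1..n+1. y j * int (w j)) - t * (\<Sum>j=1..n+1. ?B k j * int (w j))"
    by (simp add: left_diff_distrib sum_subtractf sum_distrib_left mult.assoc del: sum.cl_ivl_Suc)
  then have "(\<Sum>j=1..n+1. ?y j * int (w j)) = 0"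
    unfolding step.prems(2) B_w[OF k] by simp
  moreover have "?y j = 0" if "1 \<le> j" "j < Suc k" for j
  proof (cases "j = k")
    case False
    then show ?thesis using that step.prems(1)[of j] k by (simp add: B_mat_lower)
  qed (simp add: t)
  ultimately obtain m where m: "\<forall>j\<in>{1..n+1}. ?y j = (\<Sum>i=1..n. m i * ?B i j)"
    using step.IH[of ?y] by blast
  have "y j = (\<Sum>i=1..n. (m i + of_bool (i = k) * t) * ?B i j)" if "j \<in> {1..n+1}" for j
  proof -
    have "(\<Sum>i=1..n. (m i + of_bool (i = k) * t) * ?B i j) =
        (\<Sum>i=1..n. m i * ?B i j) + (\<Sum>i=1..n. if i = k then t * ?B k j else 0)"
      by (subst sum.distrib[symmetric]) (rule sum.cong, auto simp: distrib_right)
    also have "\<dots> = y j" using m[rule_format, OF that] k by simp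
    finally show ?thesis ..
  qed
  then show ?case by (intro exI[of _ "\<lambda>i. m i + of_bool (i = k) * t"]) blast
qed

text \<open>In column \<open>j\<close> the rows below the diagonal vanish by triangularity and those
  above drop out by induction, which leaves the nonzero diagonal entry.\<close>

lemma B_mat_rows_indep:
  assumes w: "\<forall>i\<in>{1..n+1}. w i > 0"
    and m: "\<forall>j\<in>{1..n+1}. (\<Sum>i=1..n. m i * B_mat n w b i j) = 0"
  shows "\<forall>i\<in>{1..n}. m i = 0"
proof
  fix j assume "j \<in> {1..n}"
  then show "m j = 0"
  proof (induction j rule: less_induct)
    case (less j)
    have "(\<Sum>i=1..n. m i * B_mat n w b i j) = (\<Sum>i\<in>{j}. m i * B_mat n w b i j)"
    proof (rule sum.mono_neutral_right)
      show "\<forall>i\<in>{1..n} - {j}. m i * B_mat n w b i j = 0"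
      proof
        fix i assume i: "i \<in> {1..n} - {j}"
        then show "m i * B_mat n w b i j = 0"
          using less.IH[of i] B_mat_lower[of j i n w b] by (cases "i < j") auto
      qed
    qed (use less.prems in auto)
    then have "m j * B_mat n w b j j = 0" using m less.prems by simp
    moreover have "B_mat n w b j j \<noteq> 0"
    proof -
      have "lam n w (Suc j) > 0" "lam n w j > 0" using w less.prems by (auto intro!: lam_pos)
      moreover have "lam n w j dvd lam n w (Suc j)" using less.prems by (simp add: lam_Suc[of j])
      ultimately show ?thesis using less.prems by (auto simp: B_mat_diag dvd_div_eq_0_iff)
    qed
    ultimately show ?case by simp
  qed
qed

theorem proposition2p5:
  fixes n :: nat and w :: "nat \<Rightarrow> nat" and b :: "nat \<Rightarrow> nat \<Rightarrow> int"
  assumes "n \<ge> 1"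
    and "\<forall>i\<in>{1..n+1}. w i > 0"
    and "lam n w 1 = 1"
    and "\<forall>i\<in>{1..n-1}. int (lam n w (i+1) div lam n w i) * int (w i)
           + (\<Sum>j=i+1..n+1. b i j * int (w j)) = 0"
    and "\<forall>i\<in>{2..n-1}. \<forall>l\<in>{1..i-1}. 0 \<le> b l i \<and> b l i < int (lam n w (i+1) div lam n w i)"
  defines "B \<equiv> B_mat n w b"
  defines "\<beta> \<equiv> mat_hom n (n+1) B"
  defines "\<Sigma> \<equiv> columns_fan n B"
  shows "stacky_fan n (n+1) \<Sigma> \<beta> \<and>
    equivalent_over
      (toric_DM_stack n (n+1) \<Sigma> \<beta> ::
        (('a, ((nat \<Rightarrow> int) \<Rightarrow> int) set \<Rightarrow> 'a, nat \<Rightarrow> 'a) torsor_over,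
         ('a \<Rightarrow> 'a) \<times> ('a \<Rightarrow> 'a), 'a calg, 'a \<Rightarrow> 'a) cat_over)
      (weighted_projective_stack (n+1) w)"
proof -
  interpret weight_matrix n w B
  proof
    show B_w: "(\<Sum>j=1..n+1. B i j * int (w j)) = 0" if "i \<in> {1..n}" for i
      unfolding B_def by (rule B_mat_weights[OF that assms(4)])
    \<comment> \<open>Elimination starts at position 1, where the condition of vanishing before that
      position is vacuous.\<close>
    show "\<exists>m. \<forall>j\<in>{1..n+1}. y j = (\<Sum>i=1..n. m i * B i j)"
      if "(\<Sum>j=1..n+1. y j * int (w j)) = 0" for y
      unfolding B_def using that
      by (intro B_mat_rows_span[of n w b 1] assms(2) B_w[unfolded B_def]) auto
    show "\<forall>i\<in>{1..n}. m i = 0" if "\<forall>j\<in>{1..n+1}. (\<Sum>i=1..n. m i * B i j) = 0" for m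
      using that unfolding B_def by (rule B_mat_rows_indep[OF assms(2)])
    show "\<exists>u :: nat \<Rightarrow> int. (\<Sum>j=1..n+1. u j * int (w j)) = 1"
      using bezout_Gcd[of "{1..n+1}" w] assms(3) by (simp only: lam_def finite_atLeastAtMost) simp
  qed (use assms(1,2) in auto)
  show ?thesis
    unfolding \<Sigma>_def \<beta>_def toric_DM_stack_def weighted_projective_stack_def
    using stacky_fan_\<Sigma> iso_actions.equivalent_quotient_stacks[OF iso_actions_toric_weighted] ..
qed

end
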